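(* Let $0<q<1$, $\alpha\in\mathbb{R}$ with $|\alpha|>1$, $\lambda>0$, $j\in\mathbb{N}$, and let $\{\mathbb{H}_n(x;q)\}_{n\ge0}$ be the $q$-Hermite I-Sobolev type polynomials. Then for every integer $n\ge2$ the following identity of rational functions in $x$ holds: $$\Xi_{1,n}(x)\,D_q^2\mathbb{H}_n(x;q)=\mathcal{E}_{6,n}(x)\,\mathbb{H}_n(x;q)+\mathcal{F}_{6,n}(x)\,\mathbb{H}_{n-1}(x;q),$$ where $$\mathcal{E}_{6,n}(x)=-\begin{vmatrix}\mathcal{E}_{2,n}(x)&\mathcal{E}_{5,n}(x)\\ \mathcal{F}_{2,n}(x)&\mathcal{F}_{5,n}(x)\end{vmatrix},\qquad \mathcal{F}_{6,n}(x)=\begin{vmatrix}\mathcal{E}_{1,n}(x)&\mathcal{E}_{5,n}(x)\\ \mathcal{F}_{1,n}(x)&\mathcal{F}_{5,n}(x)\end{vmatrix}.$$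
   Context: Here $\mathbb{N}=\{0,1,2,\dots\}$ and $0<q<1$. Notation: $[n]_q=\frac{1-q^n}{1-q}$, $[0]_q!=1$, $[n]_q!=[n]_q\cdots[1]_q$; $(a;q)_n=\prod_{i=0}^{n-1}(1-aq^i)$ (also for $n=\infty$), $(a_1,\dots,a_r;q)_n=\prod_i(a_i;q)_n$; $[n]_q^{(k)}=\frac{(q^{-n};q)_k}{(q-1)^k}q^{kn-\binom{k}{2}}$ (equal to $[n]_q[n-1]_q\cdots[n-k+1]_q$). The $q$-derivative is $D_qf(x)=\frac{f(qx)-f(x)}{(q-1)x}$ for $x\ne0$ (and $f'(0)$ at $x=0$), $D_q^0f=f$, $D_q^k=D_q D_q^{k-1}$; it acts on rational functions in $x$ by the same formula. The $q$-subtraction power is $(x\boxminus_q y)^m=\sum_{k=0}^m\frac{[m]_q!}{[k]_q![m-k]_q!}q^{\binom{k}{2}}(-y)^kx^{m-k}$ (equal to $\prod_{i=0}^{m-1}(x-q^iy)$). Monic $q$-Hermite I polynomials: $H_n(x;q)=q^{\binom n2}\sum_{k=0}^n\frac{(q^{-n};q)_k(x^{-1};q)_k}{(q;q)_k}(-qx)^k$ for $n\ge0$, and $H_m=0$ for $m<0$; equivalently $H_0=1$, $xH_n=H_{n+1}+\gamma_nH_{n-1}$ with $\gamma_n=q^{n-1}(1-q^n)$. Put $\|H_n\|^2=(1-q)(q;q)_n(q,-1,-q;q)_\infty q^{\binom n2}$ and $K_{n,q}^{(i,l)}(x,y)=\sum_{k=0}^n\frac{(D_q^iH_k)(x;q)\,(D_q^lH_k)(y;q)}{\|H_k\|^2}$.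 Sobolev inner product (on real polynomials): $\langle f,g\rangle_\lambda=\int_{-1}^1f(x)g(x)(qx,-qx;q)_\infty d_qx+\lambda (D_q^jf)(\alpha)(D_q^jg)(\alpha)$, where $\int_{-1}^1h(t)d_qt=(1-q)\sum_{m\ge0}q^m\big(h(q^m)+h(-q^m)\big)$. $\mathbb{H}_n(x;q)$ is the monic polynomial of degree $n$, $\{\mathbb{H}_n\}$ being orthogonal with respect to $\langle\cdot,\cdot\rangle_\lambda$. Put $\mathcal{A}_n^{(j)}(x,y)=\frac{[j]_q!}{\|H_{n-1}\|^2(x\boxminus_qy)^{j+1}}\sum_{k=0}^j\frac{(D_q^kH_{n-1})(y;q)}{[k]_q!}(x\boxminus_qy)^k$, $\mathcal{B}_n^{(j)}(x,y)=-\frac{[j]_q!}{\|H_{n-1}\|^2(x\boxminus_qy)^{j+1}}\sum_{k=0}^j\frac{(D_q^kH_{n})(y;q)}{[k]_q!}(x\boxminus_qy)^k$ $(n\ge1)$. With $D_q$ acting on $x$, for $n\ge2$: $\mathcal{C}_{1,n}(x,y)=D_q\mathcal{A}_n^{(j)}(x,y)-[n-1]_q\gamma_{n-1}^{-1}\mathcal{B}_n^{(j)}(qx,y)$, $\mathcal{D}_{1,n}(x,y)=[n]_q\mathcal{A}_n^{(j)}(qx,y)+[n-1]_q\gamma_{n-1}^{-1}x\,\mathcal{B}_n^{(j)}(qx,y)+D_q\mathcal{B}_n^{(j)}(x,y)$, $\mathcal{C}_{2,n}(x,y)=D_q\mathcal{C}_{1,n}(x,y)-[n-1]_q\gamma_{n-1}^{-1}\mathcal{D}_{1,n}(qx,y)$,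 $\mathcal{D}_{2,n}(x,y)=[n]_q\mathcal{C}_{1,n}(qx,y)+[n-1]_q\gamma_{n-1}^{-1}x\,\mathcal{D}_{1,n}(qx,y)+D_q\mathcal{D}_{1,n}(x,y)$. With $c_n=\lambda\frac{[n]_q^{(j)}H_{n-j}(\alpha;q)}{1+\lambda K_{n-1,q}^{(j,j)}(\alpha,\alpha)}$: $\mathcal{E}_{1,n}(x)=1-c_n\mathcal{A}_n^{(j)}(x,\alpha)$, $\mathcal{F}_{1,n}(x)=-c_n\mathcal{B}_n^{(j)}(x,\alpha)$ $(n\ge1)$; and for $n\ge2$: $\mathcal{E}_{2,n}(x)=-\mathcal{F}_{1,n-1}(x)/\gamma_{n-1}$, $\mathcal{F}_{2,n}(x)=\mathcal{E}_{1,n-1}(x)-x\mathcal{E}_{2,n}(x)$; $\mathcal{E}_{5,n}(x)=-[n]_q^{(2)}\gamma_{n-1}^{-1}-c_n\mathcal{C}_{2,n}(x,\alpha)$, $\mathcal{F}_{5,n}(x)=[n]_q^{(2)}\gamma_{n-1}^{-1}x-c_n\mathcal{D}_{2,n}(x,\alpha)$; $\Xi_{1,n}=\mathcal{E}_{1,n}\mathcal{F}_{2,n}-\mathcal{E}_{2,n}\mathcal{F}_{1,n}$. *)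

theory Defs
  imports
    "HOL-Analysis.Analysis"
    "HOL-Computational_Algebra.Computational_Algebra"
    "HOL-Computational_Algebra.Field_as_Ring"
begin

definition qnum :: "real \<Rightarrow> nat \<Rightarrow> real" where
  "qnum q n = (1 - q ^ n) / (1 - q)"

definition qfact :: "real \<Rightarrow> nat \<Rightarrow> real" where
  "qfact q n = (\<Prod>i=1..n. qnum q i)"

definition qpoch :: "real \<Rightarrow> real \<Rightarrow> nat \<Rightarrow> real" where
  "qpoch a q n = (\<Prod>i<n. 1 - a * q ^ i)"

definition qpoch_inf :: "real \<Rightarrow> real \<Rightarrow> real" where
  "qpoch_inf a q = prodinf (\<lambda>i. 1 - a * q ^ i)"

text \<open>The \<open>q\<close>-falling factorial \<open>[n]\<^sub>q [n-1]\<^sub>q \<dots> [n-k+1]\<^sub>q\<close>. The exponent of the last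
  factor may be negative.\<close>

definition qfalling :: "real \<Rightarrow> nat \<Rightarrow> nat \<Rightarrow> real" where
  "qfalling q n k =
     qpoch (q powi (- int n)) q k / (q - 1) ^ k * q powi (int (k * n) - int (k choose 2))"

definition Dq :: "real \<Rightarrow> (real \<Rightarrow> real) \<Rightarrow> real \<Rightarrow> real" where
  "Dq q f x = (if x = 0 then deriv f 0 else (f (q * x) - f x) / ((q - 1) * x))"

definition jackson_integral :: "real \<Rightarrow> (real \<Rightarrow> real) \<Rightarrow> real" where
  "jackson_integral q h = (1 - q) * (\<Sum>m. q ^ m * (h (q ^ m) + h (- (q ^ m))))"

text \<open>The \<open>q\<close>-subtraction power \<open>(x \<boxminus>\<^sub>q y)\<^sup>m\<close>, as a polynomial in \<open>x\<close> for a fixed real \<open>y\<close>.\<close>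

definition qsub_pow :: "real \<Rightarrow> real \<Rightarrow> nat \<Rightarrow> real poly" where
  "qsub_pow q y m =
     (\<Sum>k\<le>m. monom (qfact q m / (qfact q k * qfact q (m - k)) * q ^ (k choose 2) * (- y) ^ k) (m - k))"

text \<open>Rational functions are elements of the fraction field \<open>\<real>(x)\<close>, so identities between them
  carry no side conditions about poles.\<close>

type_synonym ratfun = "real poly fract"

definition rconst :: "real \<Rightarrow> ratfun" where
  "rconst c = to_fract [:c:]"

definition rX :: ratfun where
  "rX = to_fract [:0, 1:]"

text \<open>\<open>rshift q r\<close> is \<open>r(qx)\<close>. For \<open>q \<noteq> 0\<close> it does not depend on the chosen representation
  of \<open>r\<close> as a fraction, see \<open>rshift_divide\<close>.\<close>

definition rshift :: "real \<Rightarrow> ratfun \<Rightarrow> ratfun" where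
  "rshift q r = (case quot_of_fract r of (a, b) \<Rightarrow>
     to_fract (pcompose a [:0, q:]) / to_fract (pcompose b [:0, q:]))"

definition rDq :: "real \<Rightarrow> ratfun \<Rightarrow> ratfun" where
  "rDq q r = (rshift q r - r) / (rconst (q - 1) * rX)"

lemma rshift_divide:
  assumes "q \<noteq> 0" "b \<noteq> 0"
  shows "rshift q (to_fract a / to_fract b) =
           to_fract (pcompose a [:0, q:]) / to_fract (pcompose b [:0, q:])"
proof -
  define r where "r = to_fract a / to_fract b"
  obtain c d where cd: "quot_of_fract r = (c, d)" by fastforce
  have d: "d \<noteq> 0" using snd_quot_of_fract_nonzero[of r] cd by simp
  have "r = to_fract c / to_fract d"
    using Fract_quot_of_fract[of r] cd by (simp add: Fract_conv_to_fract)
  hence "to_fract (c * b) = to_fract (a * d)"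
    using assms d by (simp add: r_def field_simps)
  hence "c * b = a * d" by (simp only: to_fract_eq_iff)
  hence "to_fract (pcompose c [:0, q:]) * to_fract (pcompose b [:0, q:]) =
         to_fract (pcompose a [:0, q:]) * to_fract (pcompose d [:0, q:])"
    by (metis pcompose_mult to_fract_mult)
  moreover have "pcompose b [:0, q:] \<noteq> 0" "pcompose d [:0, q:] \<noteq> 0"
    using assms d by (auto dest: pcompose_eq_0)
  ultimately show ?thesis
    using cd by (simp add: rshift_def r_def[symmetric] field_simps)
qed

text \<open>The factor \<open>(x\<^sup>-\<^sup>1;q)\<^sub>k x\<^sup>k\<close> of the hypergeometric formula is written as
  \<open>\<Prod>i<k. x - q\<^sup>i\<close>, which makes the definition a polynomial; \<open>poly_qHermite\<close> recovers
  the usual form. The index is an integer because negative indices occur.\<close>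

definition qHermite :: "real \<Rightarrow> int \<Rightarrow> real poly" where
  "qHermite q m = (if m < 0 then 0 else
     smult (q ^ (nat m choose 2))
       (\<Sum>k\<le>nat m. smult (qpoch (q powi (- m)) q k / qpoch q q k * (- q) ^ k)
                     (\<Prod>i<k. [:- (q ^ i), 1:])))"

lemma poly_qHermite:
  assumes "x \<noteq> 0"
  shows "poly (qHermite q (int n)) x =
    q ^ (n choose 2) * (\<Sum>k\<le>n. qpoch (q powi (- int n)) q k * qpoch (1 / x) q k / qpoch q q k
                                 * (- (q * x)) ^ k)"
proof -
  have *: "(\<Prod>i<k. x - q ^ i) = qpoch (1 / x) q k * x ^ k" for k
    using assms by (induction k) (simp_all add: qpoch_def field_simps)
  have "(- (q * x)) ^ k = (- q) ^ k * x ^ k" for k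
    by (metis mult_minus_left power_mult_distrib)
  thus ?thesis
    by (simp add: qHermite_def poly_sum poly_prod * mult_ac)
qed

definition qgamma :: "real \<Rightarrow> nat \<Rightarrow> real" where
  "qgamma q n = q powi (int n - 1) * (1 - q ^ n)"

definition qHermite_norm2 :: "real \<Rightarrow> nat \<Rightarrow> real" where
  "qHermite_norm2 q n =
     (1 - q) * qpoch q q n * (qpoch_inf q q * qpoch_inf (- 1) q * qpoch_inf (- q) q) * q ^ (n choose 2)"

definition DqH :: "real \<Rightarrow> nat \<Rightarrow> int \<Rightarrow> real \<Rightarrow> real" where
  "DqH q k m = (Dq q ^^ k) (poly (qHermite q m))"

definition qkernel :: "real \<Rightarrow> nat \<Rightarrow> nat \<Rightarrow> nat \<Rightarrow> real \<Rightarrow> real \<Rightarrow> real" where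
  "qkernel q i l n x y =
     (\<Sum>k\<le>n. DqH q i (int k) x * DqH q l (int k) y / qHermite_norm2 q k)"

definition sobolev_inner ::
    "real \<Rightarrow> real \<Rightarrow> real \<Rightarrow> nat \<Rightarrow> real poly \<Rightarrow> real poly \<Rightarrow> real" where
  "sobolev_inner q lam \<alpha> j f g =
     jackson_integral q (\<lambda>x. poly f x * poly g x * (qpoch_inf (q * x) q * qpoch_inf (- (q * x)) q))
     + lam * (Dq q ^^ j) (poly f) \<alpha> * (Dq q ^^ j) (poly g) \<alpha>"

definition qHermite_sobolev ::
    "real \<Rightarrow> real \<Rightarrow> real \<Rightarrow> nat \<Rightarrow> (nat \<Rightarrow> real poly) \<Rightarrow> bool" where
  "qHermite_sobolev q lam \<alpha> j P \<longleftrightarrow>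
     (\<forall>n. degree (P n) = n \<and> lead_coeff (P n) = 1) \<and>
     (\<forall>m n. m \<noteq> n \<longrightarrow> sobolev_inner q lam \<alpha> j (P m) (P n) = 0)"

text \<open>The functions \<open>A0\<close> to \<open>D2\<close> are rational in \<open>x\<close>; their second variable \<open>y\<close>
  is a real parameter. As \<open>n - 1\<close> is truncated, \<open>A0\<close>, \<open>B0\<close>, \<open>cn\<close>, \<open>E1\<close>, \<open>F1\<close> are meant for
  \<open>n \<ge> 1\<close> and all the others for \<open>n \<ge> 2\<close>.\<close>

definition A0 :: "real \<Rightarrow> nat \<Rightarrow> nat \<Rightarrow> real \<Rightarrow> ratfun" where
  "A0 q j n y =
     rconst (qfact q j) / (rconst (qHermite_norm2 q (n - 1)) * to_fract (qsub_pow q y (j + 1)))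
     * (\<Sum>k\<le>j. rconst (DqH q k (int n - 1) y / qfact q k) * to_fract (qsub_pow q y k))"

definition B0 :: "real \<Rightarrow> nat \<Rightarrow> nat \<Rightarrow> real \<Rightarrow> ratfun" where
  "B0 q j n y =
     - (rconst (qfact q j) / (rconst (qHermite_norm2 q (n - 1)) * to_fract (qsub_pow q y (j + 1))))
     * (\<Sum>k\<le>j. rconst (DqH q k (int n) y / qfact q k) * to_fract (qsub_pow q y k))"

definition C1 :: "real \<Rightarrow> nat \<Rightarrow> nat \<Rightarrow> real \<Rightarrow> ratfun" where
  "C1 q j n y = rDq q (A0 q j n y)
     - rconst (qnum q (n - 1) / qgamma q (n - 1)) * rshift q (B0 q j n y)"

definition D1 :: "real \<Rightarrow> nat \<Rightarrow> nat \<Rightarrow> real \<Rightarrow> ratfun" where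
  "D1 q j n y = rconst (qnum q n) * rshift q (A0 q j n y)
     + rconst (qnum q (n - 1) / qgamma q (n - 1)) * rX * rshift q (B0 q j n y)
     + rDq q (B0 q j n y)"

definition C2 :: "real \<Rightarrow> nat \<Rightarrow> nat \<Rightarrow> real \<Rightarrow> ratfun" where
  "C2 q j n y = rDq q (C1 q j n y)
     - rconst (qnum q (n - 1) / qgamma q (n - 1)) * rshift q (D1 q j n y)"

definition D2 :: "real \<Rightarrow> nat \<Rightarrow> nat \<Rightarrow> real \<Rightarrow> ratfun" where
  "D2 q j n y = rconst (qnum q n) * rshift q (C1 q j n y)
     + rconst (qnum q (n - 1) / qgamma q (n - 1)) * rX * rshift q (D1 q j n y)
     + rDq q (D1 q j n y)"

definition cn :: "real \<Rightarrow> real \<Rightarrow> real \<Rightarrow> nat \<Rightarrow> nat \<Rightarrow> real" where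
  "cn q lam \<alpha> j n =
     lam * (qfalling q n j * poly (qHermite q (int n - int j)) \<alpha>
            / (1 + lam * qkernel q j j (n - 1) \<alpha> \<alpha>))"

definition E1 :: "real \<Rightarrow> real \<Rightarrow> real \<Rightarrow> nat \<Rightarrow> nat \<Rightarrow> ratfun" where
  "E1 q lam \<alpha> j n = 1 - rconst (cn q lam \<alpha> j n) * A0 q j n \<alpha>"

definition F1 :: "real \<Rightarrow> real \<Rightarrow> real \<Rightarrow> nat \<Rightarrow> nat \<Rightarrow> ratfun" where
  "F1 q lam \<alpha> j n = - rconst (cn q lam \<alpha> j n) * B0 q j n \<alpha>"

definition E2 :: "real \<Rightarrow> real \<Rightarrow> real \<Rightarrow> nat \<Rightarrow> nat \<Rightarrow> ratfun" where
  "E2 q lam \<alpha> j n = - F1 q lam \<alpha> j (n - 1) / rconst (qgamma q (n - 1))"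

definition F2 :: "real \<Rightarrow> real \<Rightarrow> real \<Rightarrow> nat \<Rightarrow> nat \<Rightarrow> ratfun" where
  "F2 q lam \<alpha> j n = E1 q lam \<alpha> j (n - 1) - rX * E2 q lam \<alpha> j n"

definition E5 :: "real \<Rightarrow> real \<Rightarrow> real \<Rightarrow> nat \<Rightarrow> nat \<Rightarrow> ratfun" where
  "E5 q lam \<alpha> j n = - rconst (qfalling q n 2 / qgamma q (n - 1))
     - rconst (cn q lam \<alpha> j n) * C2 q j n \<alpha>"

definition F5 :: "real \<Rightarrow> real \<Rightarrow> real \<Rightarrow> nat \<Rightarrow> nat \<Rightarrow> ratfun" where
  "F5 q lam \<alpha> j n = rconst (qfalling q n 2 / qgamma q (n - 1)) * rX
     - rconst (cn q lam \<alpha> j n) * D2 q j n \<alpha>"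

definition det2 :: "'a::comm_ring_1 \<Rightarrow> 'a \<Rightarrow> 'a \<Rightarrow> 'a \<Rightarrow> 'a" where
  "det2 a b c d = a * d - b * c"

definition Xi1 :: "real \<Rightarrow> real \<Rightarrow> real \<Rightarrow> nat \<Rightarrow> nat \<Rightarrow> ratfun" where
  "Xi1 q lam \<alpha> j n = E1 q lam \<alpha> j n * F2 q lam \<alpha> j n - E2 q lam \<alpha> j n * F1 q lam \<alpha> j n"

definition E6 :: "real \<Rightarrow> real \<Rightarrow> real \<Rightarrow> nat \<Rightarrow> nat \<Rightarrow> ratfun" where
  "E6 q lam \<alpha> j n = - det2 (E2 q lam \<alpha> j n) (E5 q lam \<alpha> j n)
                              (F2 q lam \<alpha> j n) (F5 q lam \<alpha> j n)"

definition F6 :: "real \<Rightarrow> real \<Rightarrow> real \<Rightarrow> nat \<Rightarrow> nat \<Rightarrow> ratfun" where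
  "F6 q lam \<alpha> j n = det2 (E1 q lam \<alpha> j n) (E5 q lam \<alpha> j n)
                            (F1 q lam \<alpha> j n) (F5 q lam \<alpha> j n)"

end

theory Submission
  imports Defs
begin

text \<open>
  Over the field \<open>\<real>(x)\<close> the three functions \<open>HS n\<close>, \<open>HS (n - 1)\<close> and \<open>D\<^sub>q\<^sup>2 (HS n)\<close> are linear
  combinations of \<open>H\<^sub>n\<close> and \<open>H\<^bsub>n-1\<^esub>\<close>, with coefficient pairs \<open>(E1, F1)\<close>, \<open>(E2, F2)\<close> and
  \<open>(E5, F5)\<close>. Solving the first two relations for \<open>H\<^sub>n\<close> and \<open>H\<^bsub>n-1\<^esub>\<close> by Cramer's rule, with
  determinant \<open>Xi1\<close>, and inserting the result into the third one, multiplied by \<open>Xi1\<close>, gives the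
  theorem.

  The three linear combinations come from one formula,
  \<open>HS n = H\<^sub>n - c\<^sub>n K(x, \<alpha>)\<close>, where \<open>K\<close> is the \<open>j\<close>-th \<open>q\<close>-derivative in the second variable of the
  reproducing kernel of the polynomials of degree less than \<open>n\<close> (\<open>qHermite_sobolev_eq\<close>). It holds
  because \<open>HS n - H\<^sub>n\<close> has degree less than \<open>n\<close>, and its Fourier coefficient at \<open>H\<^sub>k\<close> is, by Sobolev
  orthogonality, a fixed multiple of \<open>(D\<^sub>q\<^sup>j H\<^sub>k)(\<alpha>)\<close>. The Christoffel--Darboux formula and the Leibniz
  rule then write \<open>K\<close> as \<open>A H\<^sub>n + B H\<^bsub>n-1\<^esub>\<close> (\<open>qkernel_poly_eq_A0_B0\<close>). The index \<open>n - 1\<close> is treated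
  by eliminating \<open>H\<^bsub>n-2\<^esub>\<close> with the three term recurrence, and so is each application of \<open>D\<^sub>q\<close>
  (\<open>rDq_qHermite_combination\<close>).

  This rests on four properties of the \<open>q\<close>-Hermite polynomials: the recurrence
  (\<open>qHermite_recurrence\<close>), \<open>D\<^sub>q H\<^sub>n = [n]\<^sub>q H\<^bsub>n-1\<^esub>\<close> (\<open>qderiv_qHermite\<close>), orthogonality, and the exact
  norms (both in \<open>hermite_int_mult_qHermite\<close>). The last two follow from the recurrence once the
  integral of every \<open>H\<^sub>n\<close> is known. For \<open>n \<ge> 1\<close> it vanishes by integration by parts, and for
  \<open>n = 0\<close> it is evaluated with Euler's \<open>q\<close>-exponential series.
\<close>

section \<open>Gaussian binomial coefficients and the powers \<open>(x \<boxminus>\<^sub>q y)\<^sup>m\<close>\<close>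

lemma qnum_0 [simp]: "qnum q 0 = 0"
  by (simp add: qnum_def)

lemma qnum_1 [simp]: "q < 1 \<Longrightarrow> qnum q (Suc 0) = 1"
  by (simp add: qnum_def)

lemma qnum_add: "qnum q (m + n) = qnum q m + q ^ m * qnum q n"
  by (cases "q = 1") (simp_all add: qnum_def field_simps power_add)

lemma qnum_Suc: "q < 1 \<Longrightarrow> qnum q (Suc n) = 1 + q * qnum q n"
  using qnum_add[of q 1 n] by simp

lemma one_minus_power: "q < 1 \<Longrightarrow> 1 - q ^ n = (1 - q) * qnum q n"
  by (simp add: qnum_def)

lemma qnum_pos: "\<lbrakk>0 < q; q < 1; 0 < n\<rbrakk> \<Longrightarrow> 0 < qnum q n"
  by (simp add: qnum_def power_less_one_iff)

lemma qfact_0 [simp]: "qfact q 0 = 1"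
  by (simp add: qfact_def)

lemma qfact_Suc: "qfact q (Suc n) = qnum q (Suc n) * qfact q n"
  by (simp add: qfact_def mult.commute)

lemma qfact_pos: "\<lbrakk>0 < q; q < 1\<rbrakk> \<Longrightarrow> 0 < qfact q n"
  by (auto simp: qfact_def intro!: prod_pos qnum_pos)

definition qbinom :: "real \<Rightarrow> nat \<Rightarrow> nat \<Rightarrow> real" where
  "qbinom q n k = (if k \<le> n then qfact q n / (qfact q k * qfact q (n - k)) else 0)"

lemma qbinom_0 [simp]: "\<lbrakk>0 < q; q < 1\<rbrakk> \<Longrightarrow> qbinom q n 0 = 1"
  using qfact_pos[of q n] by (simp add: qbinom_def)

lemma qbinom_self [simp]: "\<lbrakk>0 < q; q < 1\<rbrakk> \<Longrightarrow> qbinom q n n = 1"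
  using qfact_pos[of q n] by (simp add: qbinom_def)

lemma qbinom_eq_0 [simp]: "n < k \<Longrightarrow> qbinom q n k = 0"
  by (simp add: qbinom_def)

lemma qbinom_absorb:
  assumes "0 < q" "q < 1"
  shows "qbinom q (Suc n) (Suc k) * qnum q (Suc k) = qnum q (Suc n) * qbinom q n k"
  using qfact_pos[OF assms, of k] qfact_pos[OF assms, of "n - k"] qnum_pos[OF assms, of "Suc k"]
  by (auto simp: qbinom_def qfact_Suc field_simps)

lemma qbinom_absorb_comp:
  assumes "0 < q" "q < 1"
  shows "qbinom q (Suc n) k * qnum q (Suc n - k) = qnum q (Suc n) * qbinom q n k"
proof (cases "k \<le> n")
  case True
  then obtain d where "n = k + d" using le_Suc_ex by blast
  thus ?thesis
    using qfact_pos[OF assms, of k] qfact_pos[OF assms, of d] qnum_pos[OF assms, of "Suc d"]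
    by (simp add: qbinom_def qfact_Suc Suc_diff_le field_simps)
qed auto

lemma qbinom_Suc_comp:
  assumes "0 < q" "q < 1"
  shows "qbinom q n (Suc k) * qnum q (Suc k) = qbinom q n k * qnum q (n - k)"
proof (cases n)
  case (Suc m)
  thus ?thesis using qbinom_absorb[OF assms, of m k] qbinom_absorb_comp[OF assms, of m k] by simp
qed auto

text \<open>There are two \<open>q\<close>-analogues of Pascal's rule, since \<open>[n + 1]\<^sub>q\<close> can be split as
  \<open>[k + 1]\<^sub>q + q\<^bsup>k+1\<^esup> [n - k]\<^sub>q\<close> or as \<open>[n - k]\<^sub>q + q\<^bsup>n-k\<^esup> [k + 1]\<^sub>q\<close>. The first one
  drives the recurrence of the Hermite polynomials, the second one the product formula for
  \<open>(x \<boxminus>\<^sub>q y)\<^sup>m\<close>.\<close>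

lemma qbinom_Pascal:
  assumes q: "0 < q" "q < 1"
  shows "qbinom q (Suc n) (Suc k) = qbinom q n k + q ^ Suc k * qbinom q n (Suc k)"
proof (cases "k \<le> n")
  case True
  have pos: "qnum q (Suc k) > 0" using q by (simp add: qnum_pos)
  have "qnum q (Suc n) = qnum q (Suc k) + q ^ Suc k * qnum q (n - k)"
    using qnum_add[of q "Suc k" "n - k"] True by simp
  hence "qbinom q (Suc n) (Suc k) * qnum q (Suc k) =
         (qbinom q n k + q ^ Suc k * qbinom q n (Suc k)) * qnum q (Suc k)"
    using qbinom_absorb[OF q, of n k] qbinom_Suc_comp[OF q, of n k] by (simp add: algebra_simps)
  thus ?thesis using pos by simp
qed auto

lemma qbinom_Pascal':
  assumes q: "0 < q" "q < 1"
  shows "qbinom q (Suc n) (Suc k) = q ^ (n - k) * qbinom q n k + qbinom q n (Suc k)"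
proof (cases "k \<le> n")
  case True
  have pos: "qnum q (Suc k) > 0" using q by (simp add: qnum_pos)
  have "qnum q (Suc n) = qnum q (n - k) + q ^ (n - k) * qnum q (Suc k)"
    using qnum_add[of q "n - k" "Suc k"] True by simp
  hence "qbinom q (Suc n) (Suc k) * qnum q (Suc k) =
         (q ^ (n - k) * qbinom q n k + qbinom q n (Suc k)) * qnum q (Suc k)"
    using qbinom_absorb[OF q, of n k] qbinom_Suc_comp[OF q, of n k] by (simp add: algebra_simps)
  thus ?thesis using pos by simp
qed auto

lemma smult_sum_right: "smult c (sum f A) = (\<Sum>k\<in>A. smult c (f k))"
  using sum_distrib_left[of "[:c:]" f A] by simp

lemma choose_two_Suc: "Suc n choose 2 = n + (n choose 2)"
  by (simp add: numeral_2_eq_2)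

lemma qsub_pow_0 [simp]: "qsub_pow q y 0 = 1"
  by (simp add: qsub_pow_def numeral_2_eq_2)

text \<open>The step from the defining sum to the product \<open>(x - y) (x - q y) \<dots> (x - q\<^bsup>m-1\<^esup> y)\<close>.\<close>

lemma qsub_pow_Suc:
  assumes q: "0 < q" "q < 1"
  shows "qsub_pow q y (Suc m) = [:- (q ^ m * y), 1:] * qsub_pow q y m"
proof -
  define a where "a = (\<lambda>m k. qbinom q m k * q ^ (k choose 2) * (- y) ^ k)"
  have S: "qsub_pow q y m = (\<Sum>k\<le>m. monom (a m k) (m - k))" for m
    by (auto simp: qsub_pow_def a_def qbinom_def intro!: sum.cong)
  have a_Suc: "a (Suc m) (Suc k) = a m (Suc k) - q ^ m * y * a m k" if "k \<le> m" for k
  proof -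
    have "q ^ (m - k) * q ^ k = q ^ m" using that by (simp flip: power_add)
    thus ?thesis
      by (simp add: a_def qbinom_Pascal'[OF q] choose_two_Suc power_add algebra_simps)
  qed
  have "[:0, 1:] * qsub_pow q y m = (\<Sum>k\<le>m. monom (a m k) (Suc m - k))"
    unfolding S sum_distrib_left
    by (intro sum.cong) (auto simp: Suc_diff_le monom_Suc)
  also have "\<dots> = (\<Sum>k\<le>Suc m. monom (a m k) (Suc m - k))"
    by (simp add: a_def)
  also have "\<dots> = monom (a m 0) (Suc m) + (\<Sum>k\<le>m. monom (a m (Suc k)) (m - k))"
    by (subst sum.atMost_Suc_shift) simp
  finally have X: "[:0, 1:] * qsub_pow q y m = \<dots>" .
  have "qsub_pow q y (Suc m) =
        monom (a (Suc m) 0) (Suc m) + (\<Sum>k\<le>m. monom (a (Suc m) (Suc k)) (m - k))"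
    unfolding S by (subst sum.atMost_Suc_shift) simp
  also have "(\<Sum>k\<le>m. monom (a (Suc m) (Suc k)) (m - k)) =
             (\<Sum>k\<le>m. monom (a m (Suc k)) (m - k) - smult (q ^ m * y) (monom (a m k) (m - k)))"
    by (intro sum.cong) (auto simp: a_Suc smult_monom diff_monom)
  also have "\<dots> = (\<Sum>k\<le>m. monom (a m (Suc k)) (m - k)) - smult (q ^ m * y) (qsub_pow q y m)"
    by (simp add: S sum_subtractf smult_sum_right)
  also have "a (Suc m) 0 = a m 0" using q by (simp add: a_def)
  finally have "qsub_pow q y (Suc m) = [:0, 1:] * qsub_pow q y m - smult (q ^ m * y) (qsub_pow q y m)"
    unfolding X by simp
  thus ?thesis by simp
qed

lemma qsub_pow_eq_prod:
  assumes "0 < q" "q < 1"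
  shows "qsub_pow q y m = (\<Prod>i<m. [:- (q ^ i * y), 1:])"
  by (induction m) (simp_all add: qsub_pow_Suc[OF assms] mult.commute)

lemma qsub_pow_nonzero: "\<lbrakk>0 < q; q < 1\<rbrakk> \<Longrightarrow> qsub_pow q y m \<noteq> 0"
  by (simp add: qsub_pow_eq_prod)

section \<open>The monic \<open>q\<close>-Hermite polynomials\<close>

lemma qHermite_0 [simp]: "qHermite q 0 = 1"
  by (simp add: qHermite_def qpoch_def numeral_2_eq_2)

lemma qHermite_neg: "m < 0 \<Longrightarrow> qHermite q m = 0"
  by (simp add: qHermite_def)

lemma qpoch_Suc: "qpoch a q (Suc n) = qpoch a q n * (1 - a * q ^ n)"
  by (simp add: qpoch_def)

lemma qpoch_self_Suc: "qpoch q q (Suc n) = qpoch q q n * (1 - q ^ Suc n)"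
  by (simp add: qpoch_def)

lemma qpoch_self_pos: "\<lbrakk>0 < q; q < 1\<rbrakk> \<Longrightarrow> 0 < qpoch q q n"
  by (induction n) (simp_all add: qpoch_def power_Suc[symmetric] power_less_one_iff del: power_Suc)

text \<open>The coefficients of the defining hypergeometric sum are \<open>q\<close>-binomial coefficients in disguise,
  because \<open>(q\<^bsup>-n\<^esup>;q)\<^sub>k\<close> is \<open>(q;q)\<^sub>n / (q;q)\<^bsub>n-k\<^esub>\<close> up to sign and a power of \<open>q\<close>.\<close>

lemma qHermite_coeff:
  assumes q: "0 < q" "q < 1" and "k \<le> n"
  shows "q ^ (n choose 2) * (qpoch (q powi (- int n)) q k / qpoch q q k * (- q) ^ k) =
         qbinom q n k * q ^ ((n - k) choose 2)"
  using \<open>k \<le> n\<close>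
proof (induction k)
  case 0
  thus ?case using q by (simp add: qpoch_def)
next
  case (Suc k)
  define d where "d = n - Suc k"
  have n: "n = Suc k + d" using Suc.prems by (simp add: d_def)
  have pos: "1 - q ^ Suc k > 0" using q power_less_one_iff[of q "Suc k"] by simp
  have B: "qbinom q n (Suc k) * (1 - q ^ Suc k) = qbinom q n k * (1 - q ^ Suc d)"
    using qbinom_Suc_comp[OF q, of n k] q by (simp add: one_minus_power n del: power_Suc)
  have "q powi (- int n) * q ^ k * q * q ^ d = q powi (- int n) * q ^ n"
    by (simp add: n power_add)
  also have "\<dots> = 1" using q by (simp add: power_int_minus)
  finally have E: "(1 - q powi (- int n) * q ^ k) * (- q) * q ^ d = 1 - q ^ Suc d"
    by (simp add: algebra_simps)
  have IH: "q ^ (n choose 2) * (qpoch (q powi (- int n)) q k / qpoch q q k * (- q) ^ k) =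
        qbinom q n k * (q ^ d * q ^ (d choose 2))"
    using Suc.IH Suc.prems by (simp add: n Suc_diff_le choose_two_Suc power_add)
  have "q ^ (n choose 2) * (qpoch (q powi (- int n)) q (Suc k) / qpoch q q (Suc k) * (- q) ^ Suc k)
        * (1 - q ^ Suc k) =
        (q ^ (n choose 2) * (qpoch (q powi (- int n)) q k / qpoch q q k * (- q) ^ k))
        * ((1 - q powi (- int n) * q ^ k) * (- q))"
    using pos by (simp add: qpoch_self_Suc qpoch_Suc[of "q powi (- int n)"])
  also have "\<dots> = qbinom q n k * q ^ (d choose 2) *
                   ((1 - q powi (- int n) * q ^ k) * (- q) * q ^ d)"
    unfolding IH by (simp add: mult_ac)
  also have "\<dots> = qbinom q n (Suc k) * q ^ (d choose 2) * (1 - q ^ Suc k)"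
    unfolding E using B by (simp add: mult_ac)
  finally show ?case using pos unfolding d_def by (metis mult_right_cancel less_irrefl)
qed

text \<open>Multiplication by \<open>x\<close> takes each element of the basis \<open>(x \<boxminus>\<^sub>q 1)\<^sup>k\<close> to a combination of
  only two. Since the coefficients of \<open>H\<^sub>n\<close> in this basis are essentially \<open>q\<close>-binomial
  coefficients, the three term recurrence becomes an identity of Pascal type.\<close>

lemma qHermite_expansion:
  assumes q: "0 < q" "q < 1" and "n \<le> N"
  shows "qHermite q (int n) =
           (\<Sum>k\<le>N. smult (qbinom q n k * q ^ ((n - k) choose 2)) (qsub_pow q 1 k))"
proof -
  have "qHermite q (int n) =
          (\<Sum>k\<le>n. smult (qbinom q n k * q ^ ((n - k) choose 2)) (qsub_pow q 1 k))"
    by (auto simp: qHermite_def smult_sum_right qsub_pow_eq_prod[OF q] qHermite_coeff[OF q, symmetric]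
             intro!: sum.cong)
  also have "\<dots> = (\<Sum>k\<le>N. smult (qbinom q n k * q ^ ((n - k) choose 2)) (qsub_pow q 1 k))"
    using \<open>n \<le> N\<close> by (intro sum.mono_neutral_left) auto
  finally show ?thesis .
qed

lemma qHermite_1: "\<lbrakk>0 < q; q < 1\<rbrakk> \<Longrightarrow> qHermite q 1 = [:0, 1:]"
  using qHermite_expansion[of q 1 1] by (simp add: qsub_pow_Suc numeral_2_eq_2 one_pCons)

lemma qgamma_Suc: "0 < q \<Longrightarrow> qgamma q (Suc n) = q ^ n * (1 - q ^ Suc n)"
  by (simp add: qgamma_def)

lemma qgamma_pos: "\<lbrakk>0 < q; q < 1\<rbrakk> \<Longrightarrow> 0 < qgamma q (Suc n)"
  using power_less_one_iff[of q "Suc n"] by (simp add: qgamma_Suc)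

lemma qHermite_recurrence:
  assumes q: "0 < q" "q < 1"
  shows "qHermite q (int (Suc (Suc n))) =
         [:0, 1:] * qHermite q (int (Suc n)) - smult (qgamma q (Suc n)) (qHermite q (int n))"
proof -
  define c where "c = (\<lambda>n k. qbinom q n k * q ^ ((n - k) choose 2))"
  define N where "N = Suc (Suc n)"
  have H: "qHermite q (int m) = (\<Sum>k\<le>N. smult (c m k) (qsub_pow q 1 k))" if "m \<le> N" for m
    using qHermite_expansion[OF q that] by (simp add: c_def)
  have X: "[:0, 1:] * qsub_pow q 1 k = qsub_pow q 1 (Suc k) + smult (q ^ k) (qsub_pow q 1 k)" for k
    by (simp add: qsub_pow_Suc[OF q])
  have c: "c N k = (if k = 0 then 0 else c (Suc n) (k - 1)) + q ^ k * c (Suc n) k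
                   - qgamma q (Suc n) * c n k" for k
  proof (cases k)
    case 0
    thus ?thesis
      using q by (simp add: c_def N_def qgamma_Suc choose_two_Suc power_add algebra_simps)
  next
    case (Suc i)
    show ?thesis
    proof (cases "Suc i \<le> n")
      case True
      then obtain d where n: "n = Suc i + d" using le_Suc_ex by blast
      have B: "qbinom q (Suc n) (Suc i) * (1 - q ^ Suc d) = qbinom q n (Suc i) * (1 - q ^ Suc n)"
        using qbinom_absorb_comp[OF q, of n "Suc i"] q
        by (simp add: one_minus_power n Suc_diff_le del: power_Suc)
      have "c N (Suc i) - c (Suc n) i - q ^ Suc i * c (Suc n) (Suc i) =
            - (q ^ Suc i * q ^ (Suc d choose 2) * (qbinom q (Suc n) (Suc i) * (1 - q ^ Suc d)))"
        using qbinom_Pascal[OF q, of "Suc n" i]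
        by (simp add: c_def N_def n Suc_diff_le choose_two_Suc power_add algebra_simps)
      also have "\<dots> = - (qgamma q (Suc n) * c n (Suc i))"
        unfolding B using q
        by (simp add: c_def qgamma_Suc choose_two_Suc n power_add algebra_simps)
      finally show ?thesis using Suc by (simp add: algebra_simps)
    next
      case False
      hence "i = n \<or> i = Suc n \<or> Suc n < i" by auto
      thus ?thesis
        using qbinom_Pascal[OF q, of "Suc n" i] q Suc
        by (auto simp: c_def N_def choose_two_Suc distrib_right)
    qed
  qed
  have "[:0, 1:] * qHermite q (int (Suc n)) =
        (\<Sum>k\<le>Suc n. smult (c (Suc n) k) (qsub_pow q 1 (Suc k)))
        + (\<Sum>k\<le>N. smult (q ^ k * c (Suc n) k) (qsub_pow q 1 k))"
  proof -
    have "[:0, 1:] * qHermite q (int (Suc n)) =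
          (\<Sum>k\<le>N. smult (c (Suc n) k) ([:0, 1:] * qsub_pow q 1 k))"
      by (subst H) (simp add: N_def, simp only: sum_distrib_left mult_smult_right)
    also have "\<dots> = (\<Sum>k\<le>N. smult (c (Suc n) k) (qsub_pow q 1 (Suc k)))
                     + (\<Sum>k\<le>N. smult (q ^ k * c (Suc n) k) (qsub_pow q 1 k))"
      unfolding X by (simp add: smult_add_right sum.distrib mult.commute del: smult_smult)
                     (simp add: mult_ac)
    also have "(\<Sum>k\<le>N. smult (c (Suc n) k) (qsub_pow q 1 (Suc k))) =
               (\<Sum>k\<le>Suc n. smult (c (Suc n) k) (qsub_pow q 1 (Suc k)))"
      by (simp add: N_def c_def)
    finally show ?thesis .
  qed
  also have "(\<Sum>k\<le>Suc n. smult (c (Suc n) k) (qsub_pow q 1 (Suc k))) =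
             (\<Sum>k\<le>N. smult (if k = 0 then 0 else c (Suc n) (k - 1)) (qsub_pow q 1 k))"
    unfolding N_def by (subst (2) sum.atMost_Suc_shift) simp
  moreover have "smult (qgamma q (Suc n)) (qHermite q (int n)) =
        (\<Sum>k\<le>N. smult (qgamma q (Suc n) * c n k) (qsub_pow q 1 k))"
    by (subst H) (simp add: N_def, simp only: smult_sum_right smult_smult)
  ultimately have "[:0, 1:] * qHermite q (int (Suc n)) - smult (qgamma q (Suc n)) (qHermite q (int n)) =
        (\<Sum>k\<le>N. smult (c N k) (qsub_pow q 1 k))"
    by (simp only: c smult_add_left smult_diff_left sum.distrib sum_subtractf)
  thus ?thesis using H[of N] by (simp add: N_def)
qed

lemma qHermite_monic:
  assumes q: "0 < q" "q < 1"
  shows "degree (qHermite q (int n)) = n \<and> lead_coeff (qHermite q (int n)) = 1"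
proof (induction n rule: induct_nat_012)
  case (ge2 n)
  let ?X = "[:0, 1:] * qHermite q (int (Suc n))"
  let ?r = "- smult (qgamma q (Suc n)) (qHermite q (int n))"
  have "qHermite q (int (Suc n)) \<noteq> 0" using ge2 by (metis leading_coeff_0_iff zero_neq_one)
  hence "degree ?X = Suc (Suc n)" "lead_coeff ?X = 1"
    using ge2 by (auto simp del: of_nat_Suc)
  moreover have "degree ?r < Suc (Suc n)"
    using ge2 by simp
  moreover have "qHermite q (int (Suc (Suc n))) = ?r + ?X"
    by (simp only: qHermite_recurrence[OF q] diff_conv_add_uminus add.commute)
  ultimately show ?case
    using degree_add_eq_right[of ?r ?X] lead_coeff_add_le[of ?r ?X] by (simp only:)
qed (use q in \<open>simp_all add: qHermite_1\<close>)

section \<open>The \<open>q\<close>-derivative of polynomials\<close>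

text \<open>The division is exact because \<open>p (q x) - p x\<close> vanishes at \<open>x = 0\<close>.\<close>

definition qderiv :: "real \<Rightarrow> real poly \<Rightarrow> real poly" where
  "qderiv q p = (pcompose p [:0, q:] - p) div [:0, q - 1:]"

lemma qderiv_spec:
  assumes "q < 1"
  shows "[:0, q - 1:] * qderiv q p = pcompose p [:0, q:] - p"
proof -
  have "poly (pcompose p [:0, q:] - p) 0 = 0" by (simp add: poly_pcompose)
  hence "[:0, 1:] dvd pcompose p [:0, q:] - p" by (metis minus_zero poly_eq_0_iff_dvd)
  moreover have "[:0, q - 1:] = smult (q - 1) [:0, 1:]" by simp
  ultimately have "[:0, q - 1:] dvd pcompose p [:0, q:] - p"
    using assms by (simp only: smult_dvd_iff) auto
  thus ?thesis unfolding qderiv_def by (rule dvd_mult_div_cancel)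
qed

lemma qderiv_unique:
  assumes "q < 1" "[:0, q - 1:] * r = pcompose p [:0, q:] - p"
  shows "qderiv q p = r"
  unfolding qderiv_def assms(2)[symmetric] using assms(1)
  by (intro nonzero_mult_div_cancel_left) simp

text \<open>At \<open>0\<close> the two sides agree because differentiating
  \<open>(q - 1) x (D\<^sub>q p)(x) = p (q x) - p x\<close> there gives \<open>(q - 1) (D\<^sub>q p)(0) = (q - 1) p'(0)\<close>.\<close>

lemma Dq_poly:
  assumes "q < 1"
  shows "Dq q (poly p) = poly (qderiv q p)"
proof
  fix x
  have spec: "(q - 1) * x * poly (qderiv q p) x = poly p (q * x) - poly p x" for x
    using arg_cong[OF qderiv_spec[OF assms, of p], of "\<lambda>r. poly r x"]
    by (simp add: poly_pcompose mult_ac)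
  show "Dq q (poly p) x = poly (qderiv q p) x"
  proof (cases "x = 0")
    case True
    have "poly (pderiv ([:0, q - 1:] * qderiv q p)) 0 = poly (pderiv (pcompose p [:0, q:] - p)) 0"
      by (simp only: qderiv_spec[OF assms])
    hence "(q - 1) * poly (qderiv q p) 0 = (q - 1) * poly (pderiv p) 0"
      by (simp add: pderiv_mult pderiv_diff pderiv_pcompose pderiv_pCons poly_pcompose algebra_simps
               del: mult_pCons_left)
    hence "poly (qderiv q p) 0 = poly (pderiv p) 0" using assms by simp
    moreover have "deriv (poly p) 0 = poly (pderiv p) 0"
      by (intro DERIV_imp_deriv poly_DERIV)
    ultimately show ?thesis using True by (simp add: Dq_def)
  next
    case False
    thus ?thesis using spec[of x] assms by (simp add: Dq_def field_simps)
  qed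
qed

lemma Dq_funpow_poly:
  assumes "q < 1"
  shows "(Dq q ^^ k) (poly p) = poly ((qderiv q ^^ k) p)"
  by (induction k) (simp_all add: Dq_poly[OF assms])

lemma qderiv_add: "q < 1 \<Longrightarrow> qderiv q (p + r) = qderiv q p + qderiv q r"
  by (intro qderiv_unique) (assumption, simp add: distrib_left qderiv_spec pcompose_add del: mult_pCons_left)

lemma qderiv_smult: "q < 1 \<Longrightarrow> qderiv q (smult c p) = smult c (qderiv q p)"
  by (intro qderiv_unique)
     (simp_all only: mult_smult_right qderiv_spec pcompose_smult smult_diff_right)

lemma qderiv_diff: "q < 1 \<Longrightarrow> qderiv q (p - r) = qderiv q p - qderiv q r"
  using qderiv_add[of q p "smult (- 1) r"] qderiv_smult[of q "- 1" r] by simp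

lemma qderiv_X_mult:
  assumes "q < 1"
  shows "qderiv q ([:0, 1:] * p) = smult q ([:0, 1:] * qderiv q p) + p"
proof (rule qderiv_unique[OF assms])
  have "[:0, q - 1:] * (smult q ([:0, 1:] * qderiv q p) + p) =
        smult q ([:0, 1:] * ([:0, q - 1:] * qderiv q p)) + [:0, q - 1:] * p"
    by (simp only: distrib_left mult_smult_right mult.left_commute)
  also have "\<dots> = smult q ([:0, 1:] * (pcompose p [:0, q:] - p)) + [:0, q - 1:] * p"
    by (simp only: qderiv_spec[OF assms])
  also have "\<dots> = pcompose ([:0, 1:] * p) [:0, q:] - [:0, 1:] * p"
    by (simp add: pcompose_mult pcompose_pCons smult_diff_right smult_diff_left)
  finally show "[:0, q - 1:] * (smult q ([:0, 1:] * qderiv q p) + p) =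
                pcompose ([:0, 1:] * p) [:0, q:] - [:0, 1:] * p" .
qed

lemma qderiv_1 [simp]: "q < 1 \<Longrightarrow> qderiv q 1 = 0"
  by (intro qderiv_unique) (auto simp: pcompose_1)

lemma qderiv_funpow_add: "q < 1 \<Longrightarrow> (qderiv q ^^ k) (p + r) = (qderiv q ^^ k) p + (qderiv q ^^ k) r"
  by (induction k) (simp_all add: qderiv_add)

lemma qderiv_funpow_smult: "q < 1 \<Longrightarrow> (qderiv q ^^ k) (smult c p) = smult c ((qderiv q ^^ k) p)"
  by (induction k) (simp_all add: qderiv_smult)

text \<open>In the higher Leibniz rule for \<open>x p\<close> only two terms survive, since \<open>D\<^sub>q\<^sup>2 x = 0\<close>. It serves to
  apply \<open>D\<^sub>q\<^sup>k\<close> to the Christoffel--Darboux formula.\<close>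

lemma qderiv_funpow_X_mult:
  assumes "q < 1"
  shows "(qderiv q ^^ Suc k) ([:0, 1:] * p) =
         smult (q ^ Suc k) ([:0, 1:] * (qderiv q ^^ Suc k) p) + smult (qnum q (Suc k)) ((qderiv q ^^ k) p)"
proof (induction k)
  case 0
  show ?case using assms by (simp only: funpow.simps comp_def id_apply qderiv_X_mult) simp
next
  case (Suc k)
  let ?r = "(qderiv q ^^ Suc k) p"
  have "(qderiv q ^^ Suc (Suc k)) ([:0, 1:] * p) =
        smult (q ^ Suc k) (smult q ([:0, 1:] * qderiv q ?r) + ?r) + smult (qnum q (Suc k)) ?r"
    using assms by (simp only: funpow.simps(2)[of "Suc k"] comp_apply Suc.IH
                                qderiv_add qderiv_smult qderiv_X_mult) simp
  also have "\<dots> = smult (q ^ Suc (Suc k)) ([:0, 1:] * qderiv q ?r)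
                     + smult (q ^ Suc k + qnum q (Suc k)) ?r"
    by (simp only: smult_add_right smult_add_left smult_smult power_Suc2[of q "Suc k"] add.assoc)
  also have "q ^ Suc k + qnum q (Suc k) = qnum q (Suc (Suc k))"
    using assms qnum_add[of q "Suc k" 1] by simp
  finally show ?case by simp
qed

text \<open>The Hermite polynomials form an Appell sequence for \<open>D\<^sub>q\<close>: the relation is compatible with
  the three term recurrence, because \<open>q [n + 1]\<^sub>q \<gamma>\<^sub>n = [n]\<^sub>q \<gamma>\<^bsub>n+1\<^esub>\<close>.\<close>

lemma qderiv_qHermite:
  assumes q: "0 < q" "q < 1"
  shows "qderiv q (qHermite q (int (Suc n))) = smult (qnum q (Suc n)) (qHermite q (int n))"
proof (induction n rule: induct_nat_012)
  case 0
  show ?case using q qderiv_X_mult[OF q(2), of 1] by (simp add: qHermite_1)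
next
  case 1
  have X: "qderiv q [:0, 1:] = 1"
    using q qderiv_X_mult[OF q(2), of 1] by simp
  have "qHermite q 2 = [:0, 1:] * [:0, 1:] - smult (qgamma q 1) 1"
    using qHermite_recurrence[OF q, of 0] q by (simp add: qHermite_1)
  hence "qderiv q (qHermite q 2) = smult q ([:0, 1:] * 1) + [:0, 1:]"
    using q by (simp only: qderiv_diff qderiv_X_mult qderiv_smult qderiv_1 X) simp
  thus ?case using q by (simp add: qHermite_1 qnum_Suc)
next
  case (ge2 n)
  let ?H = "\<lambda>n. qHermite q (int n)"
  have g: "q * (qnum q (Suc (Suc n)) * qgamma q (Suc n)) = qgamma q (Suc (Suc n)) * qnum q (Suc n)"
    using q by (simp add: qgamma_Suc qnum_def)
  have "qderiv q (?H (Suc (Suc (Suc n)))) =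
        smult q ([:0, 1:] * smult (qnum q (Suc (Suc n))) (?H (Suc n))) + ?H (Suc (Suc n))
        - smult (qgamma q (Suc (Suc n))) (smult (qnum q (Suc n)) (?H n))"
    by (simp only: qHermite_recurrence[OF q, of "Suc n"] qderiv_diff[OF q(2)] qderiv_X_mult[OF q(2)]
                   qderiv_smult[OF q(2)] ge2)
  also have "[:0, 1:] * smult (qnum q (Suc (Suc n))) (?H (Suc n)) =
             smult (qnum q (Suc (Suc n))) (?H (Suc (Suc n)) + smult (qgamma q (Suc n)) (?H n))"
    by (simp only: qHermite_recurrence[OF q, of n] mult_smult_right diff_add_cancel)
  finally have "qderiv q (?H (Suc (Suc (Suc n)))) =
        smult (q * qnum q (Suc (Suc n)) + 1) (?H (Suc (Suc n)))
        + smult (q * (qnum q (Suc (Suc n)) * qgamma q (Suc n)) - qgamma q (Suc (Suc n)) * qnum q (Suc n)) (?H n)"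
    by (simp only: smult_add_right smult_add_left smult_diff_left smult_smult mult.assoc smult_1_left)
  also have "\<dots> = smult (qnum q (Suc (Suc (Suc n)))) (?H (Suc (Suc n)))"
    using q by (simp only: g qnum_Suc[of q "Suc (Suc n)"]) (simp add: add.commute)
  finally show ?case .
qed

lemma qfalling_Suc:
  assumes q: "0 < q" "q < 1" and "k \<le> n"
  shows "qfalling q n (Suc k) = qfalling q n k * qnum q (n - k)"
proof -
  have "qfalling q n (Suc k) =
        qfalling q n k * ((1 - q powi (- int n) * q ^ k) / (q - 1) * q powi (int n - int k))"
  proof -
    have e: "int (Suc k * n) - int (Suc k choose 2) =
          (int (k * n) - int (k choose 2)) + (int n - int k)"
      by (simp add: choose_two_Suc)
    have p: "q powi (int (Suc k * n) - int (Suc k choose 2)) =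
         q powi (int (k * n) - int (k choose 2)) * q powi (int n - int k)"
      unfolding e using q by (intro power_int_add) simp
    show ?thesis
      unfolding qfalling_def p qpoch_Suc power_Suc
      by (simp only: divide_inverse inverse_mult_distrib mult_ac)
  qed
  moreover have "(1 - q powi (- int n) * q ^ k) / (q - 1) * q powi (int n - int k) = qnum q (n - k)"
  proof -
    have *: "q powi (int n - int k) = q ^ (n - k)"
      using \<open>k \<le> n\<close> by (simp flip: of_nat_diff)
    have "q powi (- int n) * q ^ k * q ^ (n - k) = q powi (- int n) * q ^ n"
      using \<open>k \<le> n\<close> by (simp add: mult.assoc flip: power_add)
    also have "\<dots> = 1" using q by (simp add: power_int_minus)
    finally have "(1 - q powi (- int n) * q ^ k) * q ^ (n - k) = - (1 - q ^ (n - k))"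
      by (simp add: algebra_simps)
    thus ?thesis unfolding * qnum_def using q by (simp add: field_simps)
  qed
  ultimately show ?thesis by (simp only:)
qed

lemma qfalling_0 [simp]: "qfalling q n 0 = 1"
  by (simp add: qfalling_def qpoch_def numeral_2_eq_2)

text \<open>For \<open>k > n\<close> both sides vanish, as Hermite polynomials with negative index are \<open>0\<close>.\<close>

lemma qderiv_funpow_qHermite:
  assumes q: "0 < q" "q < 1"
  shows "(qderiv q ^^ k) (qHermite q (int n)) = smult (qfalling q n k) (qHermite q (int n - int k))"
proof (induction k)
  case (Suc k)
  show ?case
  proof (cases "k < n")
    case True
    hence "int n - int k = int (Suc (n - Suc k))" "int n - int (Suc k) = int (n - Suc k)"
      "n - k = Suc (n - Suc k)" by auto
    thus ?thesis
      using True Suc q by (simp only: funpow.simps comp_apply qderiv_smult qderiv_qHermite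
                        qfalling_Suc[OF q] less_imp_le smult_smult)
  next
    case False
    have "qderiv q (qHermite q (int n - int k)) = 0"
      using False q qderiv_smult[of q 0 0] by (cases "k = n") (auto simp: qHermite_neg)
    thus ?thesis
      using False Suc q by (simp add: qderiv_smult qHermite_neg)
  qed
qed auto

section \<open>Infinite \<open>q\<close>-shifted factorials\<close>

lemma convergent_prod_qpoch:
  fixes a q :: real
  assumes "0 < q" "q < 1"
  shows "convergent_prod (\<lambda>i. 1 - a * q ^ i)"
proof -
  have "summable (\<lambda>i. norm (1 - a * q ^ i - 1))"
    using assms by (simp add: abs_mult power_abs summable_geometric)
  thus ?thesis
    by (intro abs_convergent_prod_imp_convergent_prod) (simp add: abs_convergent_prod_conv_summable)
qed

lemma qpoch_tendsto:
  assumes "0 < q" "q < 1"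
  shows "qpoch a q \<longlonglongrightarrow> qpoch_inf a q"
  using convergent_prod_LIMSEQ[OF convergent_prod_qpoch[OF assms, of a]]
  unfolding LIMSEQ_lessThan_iff_atMost[symmetric] qpoch_def[abs_def] qpoch_inf_def .

lemma qpoch_inf_pos:
  assumes "0 < q" "q < 1" "a < 1"
  shows "0 < qpoch_inf a q"
proof -
  have "a * q ^ i < 1" for i
  proof (cases "a \<le> 0")
    case True
    thus ?thesis using assms mult_nonneg_nonneg[of "- a" "q ^ i"] by simp
  next
    case False
    have "a * q ^ i \<le> a * 1" using assms False by (intro mult_left_mono power_le_one) auto
    thus ?thesis using assms by simp
  qed
  thus ?thesis
    unfolding qpoch_inf_def
    by (intro less_0_prodinf convergent_prod_qpoch assms) simp
qed

lemma qpoch_add: "qpoch a q (m + n) = qpoch a q m * qpoch (a * q ^ m) q n"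
  by (induction n) (simp_all add: qpoch_Suc qpoch_def power_add mult_ac)

lemma qpoch_inf_split:
  assumes q: "0 < q" "q < 1"
  shows "qpoch_inf a q = qpoch a q m * qpoch_inf (a * q ^ m) q"
proof (rule LIMSEQ_unique)
  show "(\<lambda>n. qpoch a q (m + n)) \<longlonglongrightarrow> qpoch_inf a q"
    using LIMSEQ_ignore_initial_segment[OF qpoch_tendsto[OF q, of a], of m] by (simp add: add.commute)
  show "(\<lambda>n. qpoch a q (m + n)) \<longlonglongrightarrow> qpoch a q m * qpoch_inf (a * q ^ m) q"
    unfolding qpoch_add by (intro tendsto_intros qpoch_tendsto q)
qed

lemma qpoch_inf_mult_minus:
  assumes q: "0 < q" "q < 1"
  shows "qpoch_inf a q * qpoch_inf (- a) q = qpoch_inf (a\<^sup>2) (q\<^sup>2)"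
proof (rule LIMSEQ_unique)
  have "qpoch a q n * qpoch (- a) q n = qpoch (a\<^sup>2) (q\<^sup>2) n" for n
    by (induction n) (simp_all add: qpoch_def power2_eq_square power_mult_distrib algebra_simps)
  thus "(\<lambda>n. qpoch a q n * qpoch (- a) q n) \<longlonglongrightarrow> qpoch_inf (a\<^sup>2) (q\<^sup>2)"
    using q by (simp add: qpoch_tendsto power_less_one_iff)
  show "(\<lambda>n. qpoch a q n * qpoch (- a) q n) \<longlonglongrightarrow> qpoch_inf a q * qpoch_inf (- a) q"
    by (intro tendsto_intros qpoch_tendsto q)
qed

text \<open>This is Euler's identity between partitions into odd and into distinct parts: the factors of
  \<open>(q;q)\<^sub>2\<^sub>N\<close> with even exponent are \<open>(q;q)\<^sub>N (-q;q)\<^sub>N\<close>.\<close>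

lemma qpoch_inf_odd_distinct:
  assumes q: "0 < q" "q < 1"
  shows "qpoch_inf q (q\<^sup>2) * qpoch_inf (- q) q = 1"
proof -
  have "qpoch q (q\<^sup>2) n * qpoch (- q) q n * qpoch q q n = qpoch q q (2 * n)" for n
    by (induction n) (simp_all add: qpoch_def power_mult power2_eq_square algebra_simps)
  moreover have "(\<lambda>n. qpoch q (q\<^sup>2) n * qpoch (- q) q n * qpoch q q n)
                   \<longlonglongrightarrow> qpoch_inf q (q\<^sup>2) * qpoch_inf (- q) q * qpoch_inf q q"
    using q by (intro tendsto_intros qpoch_tendsto) (auto simp: power_less_one_iff)
  moreover have "(\<lambda>n. qpoch q q (2 * n)) \<longlonglongrightarrow> qpoch_inf q q"
    using LIMSEQ_subseq_LIMSEQ[OF qpoch_tendsto[OF q, of q], of "\<lambda>n. 2 * n"]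
    by (simp add: comp_def strict_mono_def)
  ultimately have "qpoch_inf q (q\<^sup>2) * qpoch_inf (- q) q * qpoch_inf q q = qpoch_inf q q"
    by (simp only: LIMSEQ_unique)
  thus ?thesis using qpoch_inf_pos[OF q q(2)] by simp
qed

lemma summable_power_mult_Bseq:
  fixes z :: real
  assumes "0 \<le> z" "z < 1" "Bseq f"
  shows "summable (\<lambda>m. z ^ m * f m)"
proof -
  obtain C where C: "\<And>m. norm (f m) \<le> C" using assms(3) by (auto simp: Bseq_def)
  show ?thesis
  proof (rule summable_comparison_test')
    show "summable (\<lambda>m. z ^ m * C)" using assms by (intro summable_mult2 summable_geometric) auto
    show "norm (z ^ m * f m) \<le> z ^ m * C" for m
      using C[of m] assms by (simp add: abs_mult mult_left_mono)
  qed
qed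

lemma Bseq_inverse_qpoch:
  assumes "0 < q" "q < 1"
  shows "Bseq (\<lambda>m. 1 / qpoch q q m)"
proof -
  have "(\<lambda>m. 1 / qpoch q q m) \<longlonglongrightarrow> 1 / qpoch_inf q q"
    using qpoch_inf_pos[OF assms assms(2)] by (intro tendsto_intros qpoch_tendsto assms) auto
  thus ?thesis by (intro convergent_imp_Bseq convergentI)
qed

text \<open>Euler's first \<open>q\<close>-exponential series. Comparing coefficients shows
  \<open>(1 - z) S(z) = S(p z)\<close> for the sum \<open>S\<close>; iterating this moves the argument to \<open>0\<close>, where
  the power series \<open>S\<close> is continuous with value \<open>1\<close>.\<close>

lemma Euler_qexp_suminf:
  assumes p: "0 < p" "p < 1" and z: "0 \<le> z" "z < 1"
  shows "(\<Sum>m. z ^ m / qpoch p p m) = 1 / qpoch_inf z p"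
proof -
  define c where "c = (\<lambda>m. 1 / qpoch p p m)"
  define S where "S = (\<lambda>z. \<Sum>m. c m * z ^ m)"
  have summ: "summable (\<lambda>m. c m * w ^ m)" if "0 \<le> w" "w < 1" for w
    using summable_power_mult_Bseq[OF that Bseq_inverse_qpoch[OF p]] by (simp add: c_def mult.commute)
  have step: "(1 - w) * S w = S (w * p)" if w: "0 \<le> w" "w < 1" for w
  proof -
    have wp: "0 \<le> w * p" "w * p < 1"
      using w p by (auto intro: le_less_trans[OF mult_left_le])
    have c_Suc: "c (Suc m) * (1 - p ^ Suc m) = c m" for m
    proof -
      have "p ^ Suc m < 1" using p by (simp add: power_less_one_iff del: power_Suc)
      thus ?thesis by (simp add: c_def qpoch_self_Suc del: power_Suc)
    qed
    have "S w - S (w * p) = (\<Sum>m. c m * w ^ m - c m * (w * p) ^ m)"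
      unfolding S_def by (intro suminf_diff summ w wp)
    also have "\<dots> = (\<Sum>m. c (Suc m) * w ^ Suc m - c (Suc m) * (w * p) ^ Suc m)"
      using suminf_split_head[OF summable_diff[OF summ[OF w] summ[OF wp]]] by simp
    also have "\<dots> = (\<Sum>m. w * (c m * w ^ m))"
    proof (rule arg_cong[where f = suminf], rule ext)
      fix m
      show "c (Suc m) * w ^ Suc m - c (Suc m) * (w * p) ^ Suc m = w * (c m * w ^ m)"
        unfolding c_Suc[symmetric, of m] by (simp add: power_mult_distrib algebra_simps)
    qed
    also have "\<dots> = w * S w"
      unfolding S_def by (intro suminf_mult summ w)
    finally show ?thesis by (simp add: algebra_simps)
  qed
  have iter: "qpoch z p n * S z = S (z * p ^ n)" for n
  proof (induction n)
    case (Suc n)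
    have "z * p ^ n \<le> z * 1" using p z by (intro mult_left_mono power_le_one) auto
    hence "(1 - z * p ^ n) * S (z * p ^ n) = S (z * p ^ n * p)"
      using p z by (intro step) auto
    thus ?case unfolding qpoch_Suc Suc.IH[symmetric] by (simp add: mult_ac)
  qed (simp add: qpoch_def)
  have "isCont S 0"
    unfolding S_def using summ[of "1/2"] by (intro isCont_powser[where K = "1/2"]) auto
  moreover have "(\<lambda>n. z * p ^ n) \<longlonglongrightarrow> 0"
    using p by (intro tendsto_mult_right_zero LIMSEQ_realpow_zero) auto
  ultimately have "(\<lambda>n. S (z * p ^ n)) \<longlonglongrightarrow> S 0"
    by (rule isCont_tendsto_compose)
  moreover have "S 0 = c 0" unfolding S_def by (rule powser_zero)
  hence "S 0 = 1" by (simp add: c_def qpoch_def)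
  moreover have "(\<lambda>n. qpoch z p n * S z) \<longlonglongrightarrow> qpoch_inf z p * S z"
    by (intro tendsto_intros qpoch_tendsto p)
  ultimately have "qpoch_inf z p * S z = 1"
    unfolding iter using LIMSEQ_unique by metis
  moreover have "S z = (\<Sum>m. z ^ m / qpoch p p m)"
    by (simp add: S_def c_def)
  ultimately show ?thesis
    using qpoch_inf_pos[OF p z(2)] by (simp add: field_simps)
qed

section \<open>Orthogonality of the \<open>q\<close>-Hermite polynomials\<close>

definition hermite_int :: "real \<Rightarrow> real poly \<Rightarrow> real" where
  "hermite_int q p =
     jackson_integral q (\<lambda>x. poly p x * (qpoch_inf (q * x) q * qpoch_inf (- (q * x)) q))"

text \<open>The weight function at the two nodes \<open>q\<^sup>m\<close> and \<open>-q\<^sup>m\<close> of the Jackson integral; it is even.\<close>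

definition hermite_weight :: "real \<Rightarrow> nat \<Rightarrow> real" where
  "hermite_weight q m = qpoch_inf (q * q ^ m) q * qpoch_inf (- (q * q ^ m)) q"

lemma hermite_int_eq_suminf:
  "hermite_int q p =
     (1 - q) * (\<Sum>m. q ^ m * (hermite_weight q m * (poly p (q ^ m) + poly p (- (q ^ m)))))"
  by (simp add: hermite_int_def jackson_integral_def hermite_weight_def algebra_simps)

lemma hermite_weight_eq:
  assumes q: "0 < q" "q < 1"
  shows "hermite_weight q m = qpoch_inf (q\<^sup>2) (q\<^sup>2) / qpoch (q\<^sup>2) (q\<^sup>2) m"
proof -
  have q2: "0 < q\<^sup>2" "q\<^sup>2 < 1" using q by (auto simp: power_less_one_iff)
  have "hermite_weight q m = qpoch_inf (q\<^sup>2 * (q\<^sup>2) ^ m) (q\<^sup>2)"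
    by (simp add: hermite_weight_def qpoch_inf_mult_minus[OF q] power_mult_distrib
             flip: power_mult) (simp add: mult.commute)
  thus ?thesis
    using qpoch_inf_split[OF q2, of "q\<^sup>2" m] qpoch_self_pos[OF q2, of m] by (simp add: field_simps)
qed

lemma hermite_weight_Suc:
  assumes q: "0 < q" "q < 1"
  shows "(1 - (q ^ Suc m)\<^sup>2) * hermite_weight q (Suc m) = hermite_weight q m"
proof -
  have q2: "0 < q\<^sup>2" "q\<^sup>2 < 1" using q by (auto simp: power_less_one_iff)
  have *: "(q ^ Suc m)\<^sup>2 = (q\<^sup>2) ^ Suc m" by (simp only: power_mult[symmetric] mult.commute)
  have "(q\<^sup>2) ^ Suc m < 1" using q2 by (simp add: power_less_one_iff del: power_Suc)
  thus ?thesis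
    using qpoch_self_pos[OF q2, of m] unfolding hermite_weight_eq[OF q] qpoch_self_Suc *
    by (simp add: field_simps)
qed

lemma hermite_weight_tendsto:
  assumes q: "0 < q" "q < 1"
  shows "hermite_weight q \<longlonglongrightarrow> 1"
proof -
  have q2: "0 < q\<^sup>2" "q\<^sup>2 < 1" using q by (auto simp: power_less_one_iff)
  have "(\<lambda>m. qpoch_inf (q\<^sup>2) (q\<^sup>2) / qpoch (q\<^sup>2) (q\<^sup>2) m)
          \<longlonglongrightarrow> qpoch_inf (q\<^sup>2) (q\<^sup>2) / qpoch_inf (q\<^sup>2) (q\<^sup>2)"
    using qpoch_inf_pos[OF q2 q2(2)] by (intro tendsto_intros qpoch_tendsto q2) auto
  thus ?thesis using qpoch_inf_pos[OF q2 q2(2)] by (simp add: hermite_weight_eq[OF q, abs_def])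
qed

lemma tendsto_poly_power:
  fixes q :: real
  assumes "0 < q" "q < 1"
  shows "(\<lambda>m. poly p (q ^ m)) \<longlonglongrightarrow> poly p 0" "(\<lambda>m. poly p (- (q ^ m))) \<longlonglongrightarrow> poly p 0"
proof -
  have "(\<lambda>m. q ^ m) \<longlonglongrightarrow> 0" using assms by (intro LIMSEQ_realpow_zero) auto
  moreover from tendsto_minus[OF this] have "(\<lambda>m. - (q ^ m)) \<longlonglongrightarrow> 0" by simp
  ultimately show "(\<lambda>m. poly p (q ^ m)) \<longlonglongrightarrow> poly p 0" "(\<lambda>m. poly p (- (q ^ m))) \<longlonglongrightarrow> poly p 0"
    by (auto intro: isCont_tendsto_compose[OF poly_isCont])
qed

lemma hermite_int_summable:
  assumes q: "0 < q" "q < 1"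
  shows "summable (\<lambda>m. q ^ m * (hermite_weight q m * (poly p (q ^ m) + poly p (- (q ^ m)))))"
proof (rule summable_power_mult_Bseq)
  have "Bseq (\<lambda>m. poly p (q ^ m) + poly p (- (q ^ m)))"
    by (rule convergent_imp_Bseq[OF convergentI[OF tendsto_add[OF tendsto_poly_power[OF q]]]])
  thus "Bseq (\<lambda>m. hermite_weight q m * (poly p (q ^ m) + poly p (- (q ^ m))))"
    by (intro Bseq_mult convergent_imp_Bseq[OF convergentI[OF hermite_weight_tendsto[OF q]]])
qed (use q in auto)

lemma hermite_int_add:
  assumes q: "0 < q" "q < 1"
  shows "hermite_int q (p + r) = hermite_int q p + hermite_int q r"
  using suminf_add[OF hermite_int_summable[OF q, of p] hermite_int_summable[OF q, of r]]
  by (simp add: hermite_int_eq_suminf flip: distrib_left) (simp add: algebra_simps)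

lemma hermite_int_smult:
  assumes q: "0 < q" "q < 1"
  shows "hermite_int q (smult c p) = c * hermite_int q p"
  using suminf_mult[OF hermite_int_summable[OF q, of p], of c]
  by (simp add: hermite_int_eq_suminf algebra_simps)

lemma hermite_int_diff:
  assumes q: "0 < q" "q < 1"
  shows "hermite_int q (p - r) = hermite_int q p - hermite_int q r"
  using hermite_int_add[OF q, of p "smult (- 1) r"] hermite_int_smult[OF q, of "- 1" r] by simp

lemma hermite_int_0 [simp]: "hermite_int q 0 = 0"
  by (simp add: hermite_int_eq_suminf)

lemma hermite_int_sum:
  assumes q: "0 < q" "q < 1"
  shows "hermite_int q (\<Sum>i\<in>A. f i) = (\<Sum>i\<in>A. hermite_int q (f i))"
  by (induction A rule: infinite_finite_induct) (simp_all add: hermite_int_add[OF q])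

text \<open>Integration by parts. The weight \<open>w\<close> satisfies \<open>w (x / q) = (1 - x\<^sup>2) w x\<close>, so
  \<open>(1 - q) D\<^sub>q p - x p\<close> times \<open>w\<close> is a multiple of \<open>D\<^sub>q\<close> applied to \<open>p x * w (x / q)\<close>. The
  latter function vanishes at \<open>x = 1\<close> and \<open>x = -1\<close>, hence its \<open>q\<close>-derivative telescopes to \<open>0\<close>.\<close>

lemma hermite_int_X_mult:
  assumes q: "0 < q" "q < 1"
  shows "hermite_int q ([:0, 1:] * p) = (1 - q) * hermite_int q (qderiv q p)"
proof -
  define g where "g = [:0, 1:] * p - smult (1 - q) (qderiv q p)"
  define d where "d = (\<lambda>m. poly p (q ^ m) - poly p (- (q ^ m)))"
  define T where "T = (\<lambda>m. (1 - (q ^ m)\<^sup>2) * hermite_weight q m * d m)"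
  have g: "x * poly g x = poly p (q * x) - (1 - x\<^sup>2) * poly p x" for x
    using arg_cong[OF qderiv_spec[OF q(2), of p], of "\<lambda>r. poly r x"]
    by (simp add: g_def poly_pcompose power2_eq_square algebra_simps)
  have summand: "q ^ m * (hermite_weight q m * (poly g (q ^ m) + poly g (- (q ^ m)))) = T (Suc m) - T m" for m
  proof -
    have "q ^ m * (hermite_weight q m * (poly g (q ^ m) + poly g (- (q ^ m)))) =
          hermite_weight q m * (q ^ m * poly g (q ^ m) - (- (q ^ m)) * poly g (- (q ^ m)))"
      by (simp add: algebra_simps)
    also have "\<dots> = hermite_weight q m * d (Suc m) - T m"
      unfolding g by (simp add: d_def T_def algebra_simps)
    also have "hermite_weight q m * d (Suc m) = T (Suc m)"
      by (simp only: T_def hermite_weight_Suc[OF q])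
    finally show ?thesis .
  qed
  have "T \<longlonglongrightarrow> 0"
  proof -
    have "d \<longlonglongrightarrow> 0"
      using tendsto_diff[OF tendsto_poly_power[OF q, of p]] by (simp add: d_def)
    moreover have "(\<lambda>m. q ^ m) \<longlonglongrightarrow> 0"
      using q by (intro LIMSEQ_realpow_zero) auto
    ultimately have "T \<longlonglongrightarrow> (1 - 0\<^sup>2) * 1 * 0"
      unfolding T_def
      by (intro tendsto_mult tendsto_diff tendsto_const tendsto_power hermite_weight_tendsto[OF q])
    thus ?thesis by simp
  qed
  hence "(\<lambda>m. T (Suc m) - T m) sums (0 - T 0)" by (rule telescope_sums)
  hence "(\<Sum>m. T (Suc m) - T m) = 0 - T 0" by (simp only: sums_iff)
  moreover have "T 0 = 0" by (simp add: T_def)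
  ultimately have "hermite_int q g = 0"
    by (simp only: hermite_int_eq_suminf summand) simp
  thus ?thesis
    by (simp add: g_def hermite_int_diff[OF q] hermite_int_smult[OF q] del: mult_pCons_left)
qed

lemma qHermite_norm2_pos:
  assumes q: "0 < q" "q < 1"
  shows "0 < qHermite_norm2 q n"
  using q by (simp add: qHermite_norm2_def qpoch_inf_pos qpoch_self_pos)

lemma qHermite_norm2_Suc:
  assumes q: "0 < q" "q < 1"
  shows "qHermite_norm2 q (Suc n) = qgamma q (Suc n) * qHermite_norm2 q n"
  using q by (simp add: qHermite_norm2_def qgamma_Suc qpoch_self_Suc choose_two_Suc power_add)

text \<open>The total mass is a value of Euler's \<open>q\<close>-exponential series in base \<open>q\<^sup>2\<close> at the point
  \<open>q\<close>, by the explicit form of the weight at \<open>x = \<plusminus> q\<^sup>m\<close>.\<close>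

lemma hermite_int_1:
  assumes q: "0 < q" "q < 1"
  shows "hermite_int q 1 = qHermite_norm2 q 0"
proof -
  have q2: "0 < q\<^sup>2" "q\<^sup>2 < 1" using q by (auto simp: power_less_one_iff)
  have summ: "summable (\<lambda>m. q ^ m / qpoch (q\<^sup>2) (q\<^sup>2) m)"
    using summable_power_mult_Bseq[OF _ _ Bseq_inverse_qpoch[OF q2], of q] q by simp
  have "hermite_int q 1 =
        (1 - q) * (\<Sum>m. (2 * qpoch_inf (q\<^sup>2) (q\<^sup>2)) * (q ^ m / qpoch (q\<^sup>2) (q\<^sup>2) m))"
    by (simp add: hermite_int_eq_suminf hermite_weight_eq[OF q] mult_ac)
  also have "\<dots> = (1 - q) * (2 * qpoch_inf (q\<^sup>2) (q\<^sup>2)) * (1 / qpoch_inf q (q\<^sup>2))"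
    unfolding suminf_mult[OF summ] using Euler_qexp_suminf[OF q2, of q] q by simp
  also have "1 / qpoch_inf q (q\<^sup>2) = qpoch_inf (- q) q"
    using qpoch_inf_odd_distinct[OF q] qpoch_inf_pos[OF q2 q(2)] by (simp add: field_simps)
  also have "qpoch_inf (q\<^sup>2) (q\<^sup>2) = qpoch_inf q q * qpoch_inf (- q) q"
    using qpoch_inf_mult_minus[OF q, of q] by simp
  also have "2 * (qpoch_inf q q * qpoch_inf (- q) q) = qpoch_inf q q * qpoch_inf (- 1) q"
    using qpoch_inf_split[OF q, of "- 1" 1] by (simp add: qpoch_def)
  finally show ?thesis by (simp add: qHermite_norm2_def qpoch_def numeral_2_eq_2 mult_ac)
qed

text \<open>Integrating the recurrence and integrating \<open>x H\<^bsub>n+1\<^esub>\<close> by parts expresses the integral of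
  \<open>H\<^bsub>n+2\<^esub>\<close> by that of \<open>H\<^sub>n\<close>, with a factor \<open>(1 - q\<^bsup>n+1\<^esup>) (1 - q\<^sup>n)\<close> that vanishes for \<open>n = 0\<close>. So the
  even indices die out although the integral of \<open>H\<^sub>0\<close> is positive.\<close>

lemma hermite_int_qHermite:
  assumes q: "0 < q" "q < 1"
  shows "hermite_int q (qHermite q (int (Suc n))) = 0"
proof (induction n rule: induct_nat_012)
  case 0
  show ?case
    using hermite_int_X_mult[OF q, of 1] q by (simp add: qHermite_1)
next
  have rec: "hermite_int q (qHermite q (int (Suc (Suc n)))) =
     (1 - q ^ Suc n) * (1 - q ^ n) * hermite_int q (qHermite q (int n))" for n
  proof -
    have "hermite_int q (qHermite q (int (Suc (Suc n)))) =
          (1 - q) * (qnum q (Suc n) * hermite_int q (qHermite q (int n)))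
          - qgamma q (Suc n) * hermite_int q (qHermite q (int n))"
      by (simp only: qHermite_recurrence[OF q] hermite_int_diff[OF q] hermite_int_X_mult[OF q]
                     hermite_int_smult[OF q] qderiv_qHermite[OF q])
    also have "(1 - q) * (qnum q (Suc n) * hermite_int q (qHermite q (int n))) =
               (1 - q ^ Suc n) * hermite_int q (qHermite q (int n))"
      using one_minus_power[OF q(2), of "Suc n"] by simp
    finally show ?thesis by (simp only: qgamma_Suc[OF q(1)] left_diff_distrib right_diff_distrib mult_1_left mult_1_right mult_ac)
  qed
  { case 1 show ?case by (simp only: rec power_0 diff_self mult_zero_right mult_zero_left) }
  { case (ge2 n) show ?case by (simp only: rec[of "Suc n"] ge2 mult_zero_right) }
qed

text \<open>Each factor \<open>x\<close> can be absorbed by the recurrence, which moves the index by one. As long as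
  \<open>k < n\<close> the index \<open>0\<close> is never reached; for \<open>k = n\<close> only the path that goes down in every step
  reaches it, and it collects the factor \<open>\<gamma>\<^sub>1 \<dots> \<gamma>\<^sub>n\<close>.\<close>

lemma hermite_int_monom_mult:
  assumes q: "0 < q" "q < 1" and "k \<le> n"
  shows "hermite_int q (monom 1 k * qHermite q (int n)) = (if k = n then qHermite_norm2 q n else 0)"
  using \<open>k \<le> n\<close>
proof (induction k arbitrary: n)
  case 0
  show ?case
  proof (cases n)
    case 0
    thus ?thesis using hermite_int_1[OF q] by (simp add: monom_eq_1)
  next
    case (Suc m)
    thus ?thesis using hermite_int_qHermite[OF q, of m] by (simp add: monom_eq_1 del: of_nat_Suc)
  qed
next
  case (Suc k)
  then obtain m where n: "n = Suc m" and m: "k \<le> m" by (cases n) auto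
  have "monom 1 (Suc k) * qHermite q (int (Suc m)) = monom 1 k * ([:0, 1:] * qHermite q (int (Suc m)))"
    by (simp add: monom_Suc)
  also have "[:0, 1:] * qHermite q (int (Suc m)) =
             qHermite q (int (Suc (Suc m))) + smult (qgamma q (Suc m)) (qHermite q (int m))"
    by (simp only: qHermite_recurrence[OF q] diff_add_cancel)
  finally have "hermite_int q (monom 1 (Suc k) * qHermite q (int (Suc m))) =
      hermite_int q (monom 1 k * qHermite q (int (Suc (Suc m))))
      + qgamma q (Suc m) * hermite_int q (monom 1 k * qHermite q (int m))"
    by (simp only: distrib_left mult_smult_right hermite_int_add[OF q] hermite_int_smult[OF q])
  also have "hermite_int q (monom 1 k * qHermite q (int (Suc (Suc m)))) = 0"
    using m by (subst Suc.IH) auto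
  also have "hermite_int q (monom 1 k * qHermite q (int m)) = (if k = m then qHermite_norm2 q m else 0)"
    by (rule Suc.IH[OF m])
  finally show ?case unfolding n by (simp add: qHermite_norm2_Suc[OF q] del: of_nat_Suc)
qed

text \<open>As \<open>H\<^sub>n\<close> is monic, this contains both the orthogonality relations and the value of the
  squared norms.\<close>

lemma hermite_int_mult_qHermite:
  assumes q: "0 < q" "q < 1" and "degree p \<le> n"
  shows "hermite_int q (p * qHermite q (int n)) = coeff p n * qHermite_norm2 q n"
proof -
  have "(\<Sum>i\<le>n. smult (coeff p i) (monom 1 i)) = p"
    using poly_as_sum_of_monoms'[OF \<open>degree p \<le> n\<close>] by (simp add: smult_monom)
  hence "p * qHermite q (int n) = (\<Sum>i\<le>n. smult (coeff p i) (monom 1 i)) * qHermite q (int n)"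
    by (simp only:)
  also have "\<dots> = (\<Sum>i\<le>n. smult (coeff p i) (monom 1 i * qHermite q (int n)))"
    by (simp only: sum_distrib_right mult_smult_left)
  finally have "hermite_int q (p * qHermite q (int n)) =
         (\<Sum>i\<le>n. coeff p i * hermite_int q (monom 1 i * qHermite q (int n)))"
    by (simp add: hermite_int_sum[OF q] hermite_int_smult[OF q])
  also have "\<dots> = (\<Sum>i\<le>n. if i = n then coeff p n * qHermite_norm2 q n else 0)"
    by (intro sum.cong) (simp_all add: hermite_int_monom_mult[OF q])
  finally show ?thesis by simp
qed

section \<open>The Christoffel--Darboux formula\<close>

text \<open>The reproducing kernel is treated as a polynomial in \<open>x\<close> whose second argument is hit by a
  linear functional \<open>\<delta>\<close>; for \<open>\<delta> f = (D\<^sub>q\<^sup>j f) \<alpha>\<close> it becomes \<open>K\<^bsup>(0,j)\<^esup>(x, \<alpha>)\<close>.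
  Multiplying by \<open>x\<close> and multiplying the second argument by its variable differ by a sum that
  telescopes because of the three term recurrence and \<open>\<parallel>H\<^bsub>n+1\<^esub>\<parallel>\<^sup>2 = \<gamma>\<^bsub>n+1\<^esub> \<parallel>H\<^sub>n\<parallel>\<^sup>2\<close>.\<close>

lemma Christoffel_Darboux:
  fixes \<delta> :: "real poly \<Rightarrow> real"
  assumes q: "0 < q" "q < 1"
    and add: "\<And>p r. \<delta> (p + r) = \<delta> p + \<delta> r" and smult: "\<And>c p. \<delta> (smult c p) = c * \<delta> p"
  defines "H \<equiv> \<lambda>i. qHermite q (int i)"
  shows "[:0, 1:] * (\<Sum>i\<le>n. smult (\<delta> (H i) / qHermite_norm2 q i) (H i))
         - (\<Sum>i\<le>n. smult (\<delta> ([:0, 1:] * H i) / qHermite_norm2 q i) (H i)) =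
         smult (1 / qHermite_norm2 q n) (smult (\<delta> (H n)) (H (Suc n)) - smult (\<delta> (H (Suc n))) (H n))"
proof (induction n)
  case 0
  show ?case by (simp add: H_def qHermite_1[OF q] algebra_simps)
next
  case (Suc n)
  define N where "N = qHermite_norm2 q n"
  define g where "g = qgamma q (Suc n)"
  have N: "N > 0" "qHermite_norm2 q (Suc n) = g * N" and g: "g > 0"
    using qHermite_norm2_pos[OF q] qgamma_pos[OF q]
    by (simp_all add: N_def g_def qHermite_norm2_Suc[OF q])
  have X: "[:0, 1:] * H (Suc n) = H (Suc (Suc n)) + smult g (H n)"
    by (simp only: H_def g_def qHermite_recurrence[OF q] diff_add_cancel)
  have "[:0, 1:] * (\<Sum>i\<le>Suc n. smult (\<delta> (H i) / qHermite_norm2 q i) (H i))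
         - (\<Sum>i\<le>Suc n. smult (\<delta> ([:0, 1:] * H i) / qHermite_norm2 q i) (H i)) =
        smult (1 / N) (smult (\<delta> (H n)) (H (Suc n)) - smult (\<delta> (H (Suc n))) (H n))
        + smult (1 / (g * N)) (smult (\<delta> (H (Suc n))) ([:0, 1:] * H (Suc n)) - smult (\<delta> ([:0, 1:] * H (Suc n))) (H (Suc n)))"
    unfolding Suc.IH[folded N_def, symmetric]
    by (simp only: sum.atMost_Suc N(2) distrib_left mult_smult_right smult_diff_right smult_smult)
       (simp only: diff_conv_add_uminus minus_add_distrib add_ac times_divide_eq_left mult_1_left mult_1)
  also have "\<dots> = smult (1 / (g * N)) (smult (\<delta> (H (Suc n))) (H (Suc (Suc n))) - smult (\<delta> (H (Suc (Suc n)))) (H (Suc n)))"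
    unfolding X add smult using N(1) g
    by (simp add: smult_add_right smult_add_left smult_diff_right field_simps)
  finally show ?case unfolding N(2) .
qed

text \<open>Here \<open>K k\<close> stands for \<open>D\<^sub>q\<^sup>k K(x, y)\<close>, with \<open>D\<^sub>q\<close> acting on \<open>y\<close>, and
  \<open>N k\<close> for the right-hand side of the Christoffel--Darboux formula for
  \<open>\<delta> f = (D\<^sub>q\<^sup>k f) y\<close>. Applying \<open>D\<^sub>q\<^sup>k\<close> in the second variable to \<open>(x - y) K(x, y) = N(x, y)\<close> gives
  the hypotheses by the Leibniz rule; solving it successively for the functions \<open>K k\<close> gives the
  conclusion.\<close>

lemma qsub_pow_telescope:
  assumes q: "0 < q" "q < 1"
    and K0: "[:- y, 1:] * K 0 = N 0"
    and K: "\<And>k. [:- (q ^ Suc k * y), 1:] * K (Suc k) - smult (qnum q (Suc k)) (K k) = N (Suc k)"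
  shows "qsub_pow q y (Suc j) * K j =
         smult (qfact q j) (\<Sum>k\<le>j. smult (1 / qfact q k) (N k * qsub_pow q y k))"
proof (induction j)
  case 0
  show ?case using K0 by (simp add: qsub_pow_Suc[OF q] del: mult_pCons_left)
next
  case (Suc j)
  have "qsub_pow q y (Suc (Suc j)) * K (Suc j) =
        qsub_pow q y (Suc j) * ([:- (q ^ Suc j * y), 1:] * K (Suc j))"
    by (simp only: qsub_pow_Suc[OF q, of y "Suc j"] mult_ac)
  also have "[:- (q ^ Suc j * y), 1:] * K (Suc j) = N (Suc j) + smult (qnum q (Suc j)) (K j)"
    using K[of j] by (simp only: diff_eq_eq)
  also have "qsub_pow q y (Suc j) * \<dots> =
             N (Suc j) * qsub_pow q y (Suc j) + smult (qnum q (Suc j)) (qsub_pow q y (Suc j) * K j)"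
    by (simp only: distrib_left mult_smult_right mult.commute)
  also have "\<dots> = smult (qfact q (Suc j)) (smult (1 / qfact q (Suc j)) (N (Suc j) * qsub_pow q y (Suc j)))
       + smult (qfact q (Suc j)) (\<Sum>k\<le>j. smult (1 / qfact q k) (N k * qsub_pow q y k))"
    using qfact_pos[OF q, of j] qnum_pos[OF q, of "Suc j"] by (simp add: Suc.IH qfact_Suc)
  finally show ?case by (simp add: smult_add_right add.commute)
qed

text \<open>This is the kernel \<open>K\<^sub>n\<^bsup>(0,j)\<^esup>(x, y)\<close> as a polynomial in \<open>x\<close>.\<close>

definition qkernel_poly :: "real \<Rightarrow> nat \<Rightarrow> nat \<Rightarrow> real \<Rightarrow> real poly" where
  "qkernel_poly q j n y =
     (\<Sum>i\<le>n. smult (DqH q j (int i) y / qHermite_norm2 q i) (qHermite q (int i)))"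

lemma DqH_eq: "q < 1 \<Longrightarrow> DqH q k m y = poly ((qderiv q ^^ k) (qHermite q m)) y"
  by (simp add: DqH_def Dq_funpow_poly)

lemma qkernel_poly_formula:
  assumes q: "0 < q" "q < 1"
  shows "qsub_pow q y (Suc j) * qkernel_poly q j n y =
         smult (qfact q j / qHermite_norm2 q n)
           ((\<Sum>k\<le>j. smult (DqH q k (int n) y / qfact q k) (qsub_pow q y k)) * qHermite q (int (Suc n))
            - (\<Sum>k\<le>j. smult (DqH q k (int (Suc n)) y / qfact q k) (qsub_pow q y k)) * qHermite q (int n))"
proof -
  define \<delta> where "\<delta> = (\<lambda>k p. poly ((qderiv q ^^ k) p) y)"
  define H where "H = (\<lambda>i. qHermite q (int i))"
  define K where "K = (\<lambda>k. qkernel_poly q k n y)"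
  define N where "N = (\<lambda>k. smult (1 / qHermite_norm2 q n)
                              (smult (\<delta> k (H n)) (H (Suc n)) - smult (\<delta> k (H (Suc n))) (H n)))"
  have D: "DqH q k (int i) y = \<delta> k (H i)" for k i
    using q by (simp add: DqH_eq \<delta>_def H_def)
  have K_eq: "K k = (\<Sum>i\<le>n. smult (\<delta> k (H i) / qHermite_norm2 q i) (H i))" for k
    by (simp add: K_def qkernel_poly_def D H_def)
  have add: "\<delta> k (p + r) = \<delta> k p + \<delta> k r" and smult: "\<delta> k (smult c p) = c * \<delta> k p" for k p r c
    using q by (simp_all add: \<delta>_def qderiv_funpow_add qderiv_funpow_smult)
  have CD: "[:0, 1:] * K k - (\<Sum>i\<le>n. smult (\<delta> k ([:0, 1:] * H i) / qHermite_norm2 q i) (H i)) = N k" for k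
    unfolding K_eq N_def H_def using add smult by (intro Christoffel_Darboux q)
  have "\<delta> 0 ([:0, 1:] * p) = y * \<delta> 0 p" for p
    by (simp add: \<delta>_def)
  hence "(\<Sum>i\<le>n. smult (\<delta> 0 ([:0, 1:] * H i) / qHermite_norm2 q i) (H i)) = smult y (K 0)"
    by (simp add: K_eq smult_sum_right)
  hence K0: "[:- y, 1:] * K 0 = N 0"
    using CD[of 0] by simp
  have "\<delta> (Suc k) ([:0, 1:] * p) = q ^ Suc k * y * \<delta> (Suc k) p + qnum q (Suc k) * \<delta> k p" for k p
    using q by (simp only: \<delta>_def qderiv_funpow_X_mult) simp
  hence "(\<Sum>i\<le>n. smult (\<delta> (Suc k) ([:0, 1:] * H i) / qHermite_norm2 q i) (H i)) =
         smult (q ^ Suc k * y) (K (Suc k)) + smult (qnum q (Suc k)) (K k)" for k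
    by (simp only: K_eq smult_sum_right smult_smult add_divide_distrib smult_add_left sum.distrib times_divide_eq_right)
  hence K: "[:- (q ^ Suc k * y), 1:] * K (Suc k) - smult (qnum q (Suc k)) (K k) = N (Suc k)" for k
    using CD[of "Suc k"] by (simp add: algebra_simps)
  have "qsub_pow q y (Suc j) * K j =
        smult (qfact q j) (\<Sum>k\<le>j. smult (1 / qfact q k) (N k * qsub_pow q y k))"
    by (rule qsub_pow_telescope[OF q K0 K])
  also have "(\<Sum>k\<le>j. smult (1 / qfact q k) (N k * qsub_pow q y k)) =
        smult (1 / qHermite_norm2 q n)
          ((\<Sum>k\<le>j. smult (\<delta> k (H n) / qfact q k) (qsub_pow q y k)) * H (Suc n)
           - (\<Sum>k\<le>j. smult (\<delta> k (H (Suc n)) / qfact q k) (qsub_pow q y k)) * H n)"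
    unfolding N_def sum_distrib_right sum_subtractf[symmetric] smult_sum_right
    by (intro sum.cong refl) (simp add: smult_diff_right right_diff_distrib left_diff_distrib mult_ac)
  finally show ?thesis
    by (simp only: K_def D H_def smult_smult) (simp only: times_divide_eq_right mult_1_right)
qed

section \<open>The Sobolev polynomials\<close>

lemma sobolev_inner_eq:
  "sobolev_inner q lam \<alpha> j f g =
     hermite_int q (f * g) + lam * (Dq q ^^ j) (poly f) \<alpha> * (Dq q ^^ j) (poly g) \<alpha>"
  by (simp add: sobolev_inner_def hermite_int_def)

lemma sobolev_inner_add_right:
  assumes q: "0 < q" "q < 1"
  shows "sobolev_inner q lam \<alpha> j f (g + h) = sobolev_inner q lam \<alpha> j f g + sobolev_inner q lam \<alpha> j f h"
  using q by (simp add: sobolev_inner_eq Dq_funpow_poly qderiv_funpow_add hermite_int_add distrib_left)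

lemma sobolev_inner_smult_right:
  assumes q: "0 < q" "q < 1"
  shows "sobolev_inner q lam \<alpha> j f (smult c g) = c * sobolev_inner q lam \<alpha> j f g"
  using q by (simp add: sobolev_inner_eq Dq_funpow_poly qderiv_funpow_smult hermite_int_smult distrib_left)

text \<open>The bound on the degree of \<open>p\<close> is expressed by vanishing coefficients, which includes \<open>p = 0\<close>
  for \<open>n = 0\<close>. The induction removes the leading term of \<open>p\<close> with the monic polynomial \<open>HS d\<close>.\<close>

lemma sobolev_orthogonal:
  assumes q: "0 < q" "q < 1" and HS: "qHermite_sobolev q lam \<alpha> j HS"
    and p: "\<And>i. i \<ge> n \<Longrightarrow> coeff p i = 0"
  shows "sobolev_inner q lam \<alpha> j (HS n) p = 0"
proof -
  have "sobolev_inner q lam \<alpha> j (HS n) p = 0"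
    if "\<And>i. i \<ge> d \<Longrightarrow> coeff p i = 0" "d \<le> n" for d p
    using that
  proof (induction d arbitrary: p)
    case 0
    hence "p = 0" by (simp add: poly_eq_iff)
    thus ?case using sobolev_inner_smult_right[OF q, of lam \<alpha> j "HS n" 0 0] by simp
  next
    case (Suc d)
    define r where "r = p + smult (- coeff p d) (HS d)"
    have "degree (HS d) = d" "coeff (HS d) d = 1" using HS unfolding qHermite_sobolev_def by metis+
    hence "coeff r i = 0" if "i \<ge> d" for i
      using Suc.prems(1)[of i] that by (cases "i = d") (auto simp: r_def coeff_eq_0)
    hence "sobolev_inner q lam \<alpha> j (HS n) r = 0"
      using Suc.prems by (intro Suc.IH) auto
    moreover have "sobolev_inner q lam \<alpha> j (HS n) (HS d) = 0"
      using HS Suc.prems(2) by (auto simp: qHermite_sobolev_def)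
    ultimately show ?case
      by (simp only: r_def sobolev_inner_add_right[OF q] sobolev_inner_smult_right[OF q]
                        mult_zero_right add_0_right)
  qed
  thus ?thesis using p by blast
qed

lemma qHermite_orthogonal:
  assumes q: "0 < q" "q < 1"
  shows "hermite_int q (qHermite q (int i) * qHermite q (int k)) =
           (if i = k then qHermite_norm2 q k else 0)"
proof -
  have deg: "degree (qHermite q (int n)) = n" "coeff (qHermite q (int n)) n = 1" for n
    using qHermite_monic[OF q, of n] by auto
  have "hermite_int q (qHermite q (int i) * qHermite q (int k)) =
           (if i = k then qHermite_norm2 q k else 0)" if "i \<le> k" for i k
    using that by (subst hermite_int_mult_qHermite[OF q]) (auto simp: deg coeff_eq_0)
  from this[of i k] this[of k i] show ?thesis by (cases "i \<le> k") (auto simp: mult.commute)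
qed

text \<open>The difference of the two sides is orthogonal to all \<open>H\<^sub>k\<close> with \<open>k < n\<close>. If it had a leading term
  of degree \<open>m < n\<close>, its product with \<open>H\<^sub>m\<close> would have nonzero integral.\<close>

lemma qHermite_Fourier_expansion:
  assumes q: "0 < q" "q < 1" and f: "\<And>i. i \<ge> n \<Longrightarrow> coeff f i = 0"
  shows "f = (\<Sum>k<n. smult (hermite_int q (f * qHermite q (int k)) / qHermite_norm2 q k) (qHermite q (int k)))"
    (is "f = ?S")
proof (rule ccontr)
  assume "f \<noteq> ?S"
  define g where "g = f - ?S"
  hence "g \<noteq> 0" using \<open>f \<noteq> ?S\<close> by simp
  have "coeff (qHermite q (int k)) i = 0" if "k < i" for k i
    using qHermite_monic[OF q, of k] that by (simp add: coeff_eq_0)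
  hence "coeff g i = 0" if "i \<ge> n" for i
    using f that by (simp add: g_def coeff_sum)
  with \<open>g \<noteq> 0\<close> have m: "degree g < n"
    by (metis leading_coeff_0_iff not_le)
  have "hermite_int q (?S * qHermite q (int (degree g))) =
        (\<Sum>k<n. hermite_int q (f * qHermite q (int k)) / qHermite_norm2 q k
                * hermite_int q (qHermite q (int k) * qHermite q (int (degree g))))"
    by (simp only: sum_distrib_right mult_smult_left hermite_int_sum[OF q] hermite_int_smult[OF q])
  also have "\<dots> = (\<Sum>k<n. if k = degree g then hermite_int q (f * qHermite q (int (degree g))) else 0)"
    using qHermite_norm2_pos[OF q, of "degree g"]
    by (intro sum.cong) (auto simp: qHermite_orthogonal[OF q])
  also have "\<dots> = hermite_int q (f * qHermite q (int (degree g)))"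
    using m by simp
  finally have "hermite_int q (?S * qHermite q (int (degree g))) = \<dots>" .
  hence "hermite_int q (g * qHermite q (int (degree g))) = 0"
    by (simp only: g_def left_diff_distrib hermite_int_diff[OF q] diff_self)
  hence "lead_coeff g * qHermite_norm2 q (degree g) = 0"
    by (simp add: hermite_int_mult_qHermite[OF q])
  thus False using \<open>g \<noteq> 0\<close> qHermite_norm2_pos[OF q, of "degree g"] by simp
qed

text \<open>Orthogonality to the polynomials of lower degree determines the Fourier coefficients of
  \<open>HS (n + 1) - H\<^bsub>n+1\<^esub>\<close> up to the common unknown factor \<open>(D\<^sub>q\<^sup>j HS (n + 1))(\<alpha>)\<close>. Applying
  \<open>D\<^sub>q\<^sup>j\<close> at \<open>\<alpha>\<close> to the resulting formula gives a linear equation for this factor, whose coefficient \<open>1 + \<lambda> K\<close> is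
  positive.\<close>

lemma qHermite_sobolev_eq:
  assumes q: "0 < q" "q < 1" and lam: "lam > 0" and HS: "qHermite_sobolev q lam \<alpha> j HS"
  shows "HS (Suc n) = qHermite q (int (Suc n)) - smult (cn q lam \<alpha> j (Suc n)) (qkernel_poly q j n \<alpha>)"
proof -
  define H where "H = (\<lambda>i. qHermite q (int i))"
  define d where "d = (\<lambda>p. poly ((qderiv q ^^ j) p) \<alpha>)"
  define f where "f = HS (Suc n) - H (Suc n)"
  have d_smult: "d (smult c p) = c * d p" and d_add: "d (p + r) = d p + d r" for c p r
    using q by (simp_all add: d_def qderiv_funpow_smult qderiv_funpow_add)
  have d_diff: "d (p - r) = d p - d r" for p r
    using d_add[of p "smult (- 1) r"] d_smult[of "- 1" r] by simp
  have d_sum: "d (sum g A) = (\<Sum>i\<in>A. d (g i))" for g :: "nat \<Rightarrow> _" and A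
    using d_smult[of 0 0] by (induction A rule: infinite_finite_induct) (simp_all add: d_add)
  have DqH: "DqH q j (int k) \<alpha> = d (H k)" for k
    using q by (simp add: DqH_eq d_def H_def)
  have "coeff f i = 0" if "i \<ge> Suc n" for i
  proof -
    have "degree (HS (Suc n)) = Suc n" "coeff (HS (Suc n)) (Suc n) = 1"
      using HS unfolding qHermite_sobolev_def by metis+
    moreover have "degree (H (Suc n)) = Suc n" "coeff (H (Suc n)) (Suc n) = 1"
      using qHermite_monic[OF q, of "Suc n"] unfolding H_def by metis+
    ultimately show ?thesis using that by (cases "i = Suc n") (auto simp: f_def coeff_eq_0)
  qed
  hence "f = (\<Sum>k<Suc n. smult (hermite_int q (f * H k) / qHermite_norm2 q k) (H k))"
    unfolding H_def by (rule qHermite_Fourier_expansion[OF q])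
  also have "\<dots> = (\<Sum>k<Suc n. smult (- (lam * d (HS (Suc n))) * (d (H k) / qHermite_norm2 q k)) (H k))"
  proof (rule sum.cong)
    fix k assume "k \<in> {..<Suc n}"
    hence k: "k < Suc n" by simp
    have "degree (H k) = k" using qHermite_monic[OF q, of k] by (simp add: H_def)
    hence "sobolev_inner q lam \<alpha> j (HS (Suc n)) (H k) = 0"
      using k by (intro sobolev_orthogonal[OF q HS]) (simp add: coeff_eq_0)
    hence "hermite_int q (HS (Suc n) * H k) = - (lam * d (HS (Suc n))) * d (H k)"
      using q by (simp add: sobolev_inner_eq Dq_funpow_poly d_def)
    moreover have "hermite_int q (H (Suc n) * H k) = 0"
      unfolding H_def using qHermite_orthogonal[OF q, of "Suc n" k] k by simp
    ultimately have "hermite_int q (f * H k) = - (lam * d (HS (Suc n))) * d (H k)"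
      by (simp add: f_def left_diff_distrib hermite_int_diff[OF q])
    thus "smult (hermite_int q (f * H k) / qHermite_norm2 q k) (H k) =
          smult (- (lam * d (HS (Suc n))) * (d (H k) / qHermite_norm2 q k)) (H k)"
      by simp
  qed simp
  also have "\<dots> = smult (- (lam * d (HS (Suc n)))) (qkernel_poly q j n \<alpha>)"
    by (simp only: qkernel_poly_def DqH smult_sum_right smult_smult lessThan_Suc_atMost H_def)
  finally have eq: "HS (Suc n) = H (Suc n) - smult (lam * d (HS (Suc n))) (qkernel_poly q j n \<alpha>)"
    by (simp add: f_def algebra_simps)
  have ker: "d (qkernel_poly q j n \<alpha>) = qkernel q j j n \<alpha> \<alpha>"
    unfolding qkernel_poly_def qkernel_def d_sum
    by (intro sum.cong) (simp_all add: d_smult DqH H_def)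
  have "qkernel q j j n \<alpha> \<alpha> \<ge> 0"
    unfolding qkernel_def using qHermite_norm2_pos[OF q] by (intro sum_nonneg divide_nonneg_pos) auto
  hence pos: "1 + lam * qkernel q j j n \<alpha> \<alpha> > 0"
    using lam by (simp add: add_pos_nonneg)
  have "d (HS (Suc n)) = d (H (Suc n)) - lam * d (HS (Suc n)) * qkernel q j j n \<alpha> \<alpha>"
    by (subst eq) (simp only: d_diff d_smult ker)
  hence "d (HS (Suc n)) = d (H (Suc n)) / (1 + lam * qkernel q j j n \<alpha> \<alpha>)"
    using pos by (simp add: field_simps)
  moreover have "d (H (Suc n)) = qfalling q (Suc n) j * poly (qHermite q (int (Suc n) - int j)) \<alpha>"
    unfolding d_def H_def qderiv_funpow_qHermite[OF q] by simp
  ultimately have "lam * d (HS (Suc n)) = cn q lam \<alpha> j (Suc n)"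
    by (simp add: cn_def)
  with eq show ?thesis unfolding H_def by (simp only:)
qed

section \<open>The \<open>q\<close>-derivative of rational functions\<close>

lemma rshift_to_fract: "rshift q (to_fract p) = to_fract (pcompose p [:0, q:])"
  by (simp add: rshift_def pcompose_1)

lemma ratfun_cases:
  fixes r :: ratfun
  obtains a b where "b \<noteq> 0" "r = to_fract a / to_fract b"
  by (metis Fract_conv_to_fract Fract_quot_of_fract snd_quot_of_fract_nonzero)

lemma pcompose_qX_nonzero:
  fixes p :: "real poly"
  assumes "q \<noteq> 0" "p \<noteq> 0"
  shows "pcompose p [:0, q:] \<noteq> 0"
  using assms by (auto dest: pcompose_eq_0)

lemma rshift_add:
  assumes "q \<noteq> 0"
  shows "rshift q (r + s) = rshift q r + rshift q s"
proof -
  obtain a b where r: "b \<noteq> 0" "r = to_fract a / to_fract b" by (rule ratfun_cases)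
  obtain c d where s: "d \<noteq> 0" "s = to_fract c / to_fract d" by (rule ratfun_cases)
  have "r + s = to_fract (a * d + c * b) / to_fract (b * d)"
    using r s by (simp add: field_simps)
  hence "rshift q (r + s) = to_fract (pcompose (a * d + c * b) [:0, q:]) / to_fract (pcompose (b * d) [:0, q:])"
    using assms r(1) s(1) by (simp only: rshift_divide mult_eq_0_iff simp_thms)
  moreover have "rshift q r = to_fract (pcompose a [:0, q:]) / to_fract (pcompose b [:0, q:])"
    "rshift q s = to_fract (pcompose c [:0, q:]) / to_fract (pcompose d [:0, q:])"
    using assms r s by (simp_all add: rshift_divide)
  ultimately show ?thesis
    using assms r(1) s(1) by (simp add: pcompose_mult pcompose_add pcompose_qX_nonzero add_frac_eq)
qed

lemma rshift_mult:
  assumes "q \<noteq> 0"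
  shows "rshift q (r * s) = rshift q r * rshift q s"
proof -
  obtain a b where r: "b \<noteq> 0" "r = to_fract a / to_fract b" by (rule ratfun_cases)
  obtain c d where s: "d \<noteq> 0" "s = to_fract c / to_fract d" by (rule ratfun_cases)
  have "r * s = to_fract (a * c) / to_fract (b * d)" using r s by simp
  hence "rshift q (r * s) = to_fract (pcompose (a * c) [:0, q:]) / to_fract (pcompose (b * d) [:0, q:])"
    using assms r(1) s(1) by (simp only: rshift_divide mult_eq_0_iff simp_thms)
  thus ?thesis using assms r s by (simp add: rshift_divide pcompose_mult)
qed

lemma rDq_add: "q \<noteq> 0 \<Longrightarrow> rDq q (r + s) = rDq q r + rDq q s"
  by (simp add: rDq_def rshift_add add_divide_distrib diff_divide_distrib algebra_simps)

lemma rDq_mult: "q \<noteq> 0 \<Longrightarrow> rDq q (r * s) = rDq q r * s + rshift q r * rDq q s"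
  by (simp add: rDq_def rshift_mult diff_divide_distrib algebra_simps)

lemma rshift_rconst [simp]: "rshift q (rconst c) = rconst c"
  by (simp add: rconst_def rshift_to_fract)

lemma rDq_rconst_mult: "q \<noteq> 0 \<Longrightarrow> rDq q (rconst c * r) = rconst c * rDq q r"
  using rDq_mult[of q "rconst c" r] by (simp add: rDq_def)

lemma rconst_mult: "rconst (a * b) = rconst a * rconst b"
  by (simp add: rconst_def flip: to_fract_mult)

lemma rconst_eq_0_iff [simp]: "rconst a = 0 \<longleftrightarrow> a = 0"
  by (simp add: rconst_def)

lemma rconst_uminus: "rconst (- a) = - rconst a"
  by (simp add: rconst_def flip: to_fract_uminus)

lemma rconst_divide: "rconst (a / b) = rconst a / rconst b"
proof (cases "b = 0")
  case False
  thus ?thesis using rconst_mult[of "a / b" b] by (simp add: field_simps)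
qed (simp add: rconst_def)

lemma to_fract_smult: "to_fract (smult c p) = rconst c * to_fract p"
  by (simp add: rconst_def flip: to_fract_mult)

lemma rDq_to_fract:
  assumes "q < 1"
  shows "rDq q (to_fract p) = to_fract (qderiv q p)"
proof -
  have "to_fract [:0, q - 1:] * to_fract (qderiv q p) = rshift q (to_fract p) - to_fract p"
    by (simp only: qderiv_spec[OF assms] rshift_to_fract flip: to_fract_diff to_fract_mult)
  moreover have "to_fract [:0, q - 1:] = rconst (q - 1) * rX"
    by (simp add: rconst_def rX_def flip: to_fract_mult)
  moreover have "rX \<noteq> 0" by (simp add: rX_def)
  ultimately show ?thesis
    using assms by (simp add: rDq_def field_simps)
qed

section \<open>The second order relation\<close>

definition qHermite_rat :: "real \<Rightarrow> nat \<Rightarrow> ratfun" where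
  "qHermite_rat q n = to_fract (qHermite q (int n))"

lemma rDq_qHermite_rat:
  "\<lbrakk>0 < q; q < 1\<rbrakk> \<Longrightarrow> rDq q (qHermite_rat q (Suc n)) = rconst (qnum q (Suc n)) * qHermite_rat q n"
  by (simp only: qHermite_rat_def rDq_to_fract qderiv_qHermite to_fract_smult)

lemma qHermite_rat_recurrence:
  assumes q: "0 < q" "q < 1"
  shows "qHermite_rat q n =
           (rX * qHermite_rat q (Suc n) - qHermite_rat q (Suc (Suc n))) / rconst (qgamma q (Suc n))"
proof -
  have "qHermite_rat q (Suc (Suc n)) =
        rX * qHermite_rat q (Suc n) - rconst (qgamma q (Suc n)) * qHermite_rat q n"
    by (simp only: qHermite_rat_def qHermite_recurrence[OF q] to_fract_diff to_fract_mult
                   to_fract_smult rX_def)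
  thus ?thesis using qgamma_pos[OF q, of n] by (simp add: field_simps)
qed

lemma qkernel_poly_eq_A0_B0:
  assumes q: "0 < q" "q < 1"
  shows "to_fract (qkernel_poly q j n y) =
           A0 q j (Suc n) y * qHermite_rat q (Suc n) + B0 q j (Suc n) y * qHermite_rat q n"
proof -
  define P where "P = to_fract (qsub_pow q y (Suc j))"
  define c where "c = rconst (qfact q j)"
  define N where "N = rconst (qHermite_norm2 q n)"
  define S where "S = (\<lambda>m. \<Sum>k\<le>j. rconst (DqH q k m y / qfact q k) * to_fract (qsub_pow q y k))"
  have nz: "P \<noteq> 0" "N \<noteq> 0"
    using qsub_pow_nonzero[OF q] qHermite_norm2_pos[OF q, of n] by (auto simp: P_def N_def)
  have "P * to_fract (qkernel_poly q j n y) =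
        c / N * (S (int n) * qHermite_rat q (Suc n) - S (int (Suc n)) * qHermite_rat q n)"
    using arg_cong[OF qkernel_poly_formula[OF q, of y j n], of to_fract]
    by (simp only: P_def c_def N_def S_def qHermite_rat_def to_fract_mult to_fract_smult to_fract_diff
                   to_fract_sum rconst_divide)
  also have "\<dots> = P * (c / (N * P) * S (int n) * qHermite_rat q (Suc n)
                       + - (c / (N * P)) * S (int (Suc n)) * qHermite_rat q n)"
    using nz by (simp add: field_simps)
  also have "c / (N * P) * S (int n) = A0 q j (Suc n) y"
    by (simp add: A0_def c_def N_def P_def S_def)
  also have "- (c / (N * P)) * S (int (Suc n)) = B0 q j (Suc n) y"
    by (simp only: B0_def c_def N_def P_def S_def diff_Suc_1 Suc_eq_plus1[symmetric])
  finally show ?thesis using nz by simp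
qed

text \<open>One application of \<open>D\<^sub>q\<close> to \<open>a H\<^sub>n + b H\<^bsub>n-1\<^esub>\<close>: the Leibniz rule produces a term with
  \<open>H\<^bsub>n-2\<^esub>\<close>, which the recurrence eliminates. The coefficients are the ones by which
  \<open>(C1, D1)\<close> arises from \<open>(A0, B0)\<close> and \<open>(C2, D2)\<close> from \<open>(C1, D1)\<close>.\<close>

lemma rDq_qHermite_combination:
  fixes q :: real and m :: nat and a b :: ratfun
  assumes q: "0 < q" "q < 1"
  defines "g \<equiv> rconst (qnum q (Suc m) / qgamma q (Suc m))"
  shows "rDq q (a * qHermite_rat q (Suc (Suc m)) + b * qHermite_rat q (Suc m)) =
           (rDq q a - g * rshift q b) * qHermite_rat q (Suc (Suc m))
           + (rconst (qnum q (Suc (Suc m))) * rshift q a + g * rX * rshift q b + rDq q b)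
             * qHermite_rat q (Suc m)"
proof -
  have h: "rDq q (qHermite_rat q (Suc m)) =
        g * (rX * qHermite_rat q (Suc m) - qHermite_rat q (Suc (Suc m)))"
    by (simp add: rDq_qHermite_rat[OF q] qHermite_rat_recurrence[OF q, of m] g_def rconst_divide)
  have q0: "q \<noteq> 0" using q by simp
  have "rDq q (a * qHermite_rat q (Suc (Suc m)) + b * qHermite_rat q (Suc m)) =
      rDq q a * qHermite_rat q (Suc (Suc m))
      + rshift q a * (rconst (qnum q (Suc (Suc m))) * qHermite_rat q (Suc m))
      + (rDq q b * qHermite_rat q (Suc m)
         + rshift q b * (g * (rX * qHermite_rat q (Suc m) - qHermite_rat q (Suc (Suc m)))))"
    by (simp only: rDq_add[OF q0] rDq_mult[OF q0] h rDq_qHermite_rat[OF q, of "Suc m"])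
  thus ?thesis by (simp add: algebra_simps)
qed

theorem proposition8:
  fixes q \<alpha> lam :: real and j n :: nat and HS :: "nat \<Rightarrow> real poly"
  assumes "0 < q" and "q < 1" and "\<bar>\<alpha>\<bar> > 1" and "lam > 0"
    and "qHermite_sobolev q lam \<alpha> j HS"
    and "n \<ge> 2"
  shows "Xi1 q lam \<alpha> j n * (rDq q ^^ 2) (to_fract (HS n)) =
           E6 q lam \<alpha> j n * to_fract (HS n) + F6 q lam \<alpha> j n * to_fract (HS (n - 1))"
proof -
  note q = assms(1,2)
  obtain m where n: "n = Suc (Suc m)" using \<open>n \<ge> 2\<close> by (metis add_2_eq_Suc le_Suc_ex)
  define h where "h = qHermite_rat q"
  define K where "K = (\<lambda>m. to_fract (qkernel_poly q j m \<alpha>))"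
  define c where "c = rconst (cn q lam \<alpha> j n)"
  have HS_eq: "to_fract (HS (Suc i)) = h (Suc i) - rconst (cn q lam \<alpha> j (Suc i)) * K i" for i
    using qHermite_sobolev_eq[OF q assms(4,5), of i]
    by (simp add: h_def K_def qHermite_rat_def to_fract_smult del: of_nat_Suc)
  have HS_E1_F1: "to_fract (HS (Suc i)) =
      E1 q lam \<alpha> j (Suc i) * h (Suc i) + F1 q lam \<alpha> j (Suc i) * h i" for i
    unfolding HS_eq K_def qkernel_poly_eq_A0_B0[OF q] E1_def F1_def h_def
    by (simp add: algebra_simps)
  have HS_n: "to_fract (HS n) = E1 q lam \<alpha> j n * h n + F1 q lam \<alpha> j n * h (n - 1)"
    using HS_E1_F1[of "Suc m"] by (simp add: n)
  have h_m: "h m = (rX * h (Suc m) - h n) / rconst (qgamma q (n - 1))"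
    using qHermite_rat_recurrence[OF q, of m] by (simp add: h_def n)
  have HS_pred: "to_fract (HS (n - 1)) = E2 q lam \<alpha> j n * h n + F2 q lam \<alpha> j n * h (n - 1)"
    using HS_E1_F1[of m] unfolding h_m
    by (simp add: n E2_def F2_def diff_divide_distrib algebra_simps)

  have "rDq q (K (Suc m)) = C1 q j n \<alpha> * h n + D1 q j n \<alpha> * h (n - 1)"
    unfolding K_def qkernel_poly_eq_A0_B0[OF q] rDq_qHermite_combination[OF q]
    by (simp add: C1_def D1_def n h_def)
  hence K2: "rDq q (rDq q (K (Suc m))) = C2 q j n \<alpha> * h n + D2 q j n \<alpha> * h (n - 1)"
    by (simp add: h_def n rDq_qHermite_combination[OF q] C2_def D2_def)
  have "qfalling q n 2 = qnum q n * qnum q (n - 1)"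
    using qfalling_Suc[OF q, of 0 n] qfalling_Suc[OF q, of 1 n] by (simp add: n numeral_2_eq_2)
  hence h2: "rDq q (rDq q (h n)) =
      rconst (qfalling q n 2 / qgamma q (n - 1)) * (rX * h (n - 1) - h n)"
    using q by (simp add: n h_def rDq_qHermite_rat rDq_rconst_mult qHermite_rat_recurrence[OF q, of m]
                          rconst_mult rconst_divide)
  have "to_fract (HS n) = h n + (- c) * K (Suc m)"
    using HS_eq[of "Suc m"] by (simp add: n c_def)
  hence "(rDq q ^^ 2) (to_fract (HS n)) = rDq q (rDq q (h n)) - c * rDq q (rDq q (K (Suc m)))"
    using q by (simp add: numeral_2_eq_2 rDq_add rDq_rconst_mult c_def flip: rconst_uminus) (simp add: rconst_uminus)
  also have "\<dots> = E5 q lam \<alpha> j n * h n + F5 q lam \<alpha> j n * h (n - 1)"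
    unfolding h2 K2 by (simp add: E5_def F5_def c_def algebra_simps)
  finally have D2: "(rDq q ^^ 2) (to_fract (HS n)) = \<dots>" .

  show ?thesis
    unfolding D2 unfolding HS_n HS_pred Xi1_def E6_def F6_def det2_def by (simp add: algebra_simps)
qed

end
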